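(* Let the perturbed system described in the context satisfy the standing assumptions (i)–(iv) listed there. Let $n$ be the integer such that $\Lambda_k(\rho)\equiv0$ for $k\le n-1$ and $\Lambda_n(\rho)\not\equiv0$, and assume that $n=p\le q$. Assume there is $\rho_0\in\mathbb R$ with $0<|\rho_0|<r_\ast$, $\Lambda_p(\rho_0)=0$ and $\Lambda_p'(\rho_0)>0$. For $M\in\mathbb Z_+$ let $$\varrho_{2,M}(t)=\rho_0+\sum_{k=1}^Mt^{-\frac kq}\rho_k(\log t)$$ be the $M$th partial sum of the formal solution $\rho_0+\sum_{k=1}^\infty t^{-k/q}\rho_k(\log t)$, with $\rho_k(\tau)$ polynomials in $\tau$, of the equation $d\varrho/dt=\Lambda_N(\varrho,t)$. Put $\nu_0=(p-n)/q$ (so $\nu_0=0$ here). Then for all $M\in\mathbb Z_+$ there exists $\varepsilon>0$ such that for all $\delta_0\in(0,\varepsilon)$ there exist $t_s\ge t_\ast$ and a solution $r(t),\varphi(t)$ of the perturbed system with initial data $|r(t_s)-\varrho_{2,M}(t_s)|\le\delta_0$, $\varphi(t_s)\in\mathbb R$, which satisfies the inequality $t_e^{\nu_0}|r(t_e)-\varrho_{2,M}(t_e)|\ge\varepsilon$ at some $t_e>t_s$.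
   Context: $\mathbb Z_+=\{1,2,\dots\}$. Perturbed system: fix $r_0>0$, $q\in\mathbb Z_+$ and consider $$\frac{dr}{dt}=f(r,\varphi,S(t),t),\qquad \frac{d\varphi}{dt}=\omega(r)+r^{-1}g(r,\varphi,S(t),t),$$ where $\omega(r)$, $f(r,\varphi,S,t)$, $g(r,\varphi,S,t)$ are infinitely differentiable, defined for all $|r|\le r_0$, $(\varphi,S)\in\mathbb R^2$, $t>0$, and $2\pi$-periodic with respect to $\varphi$ and $S$; $\omega(r)>0$ for all $|r|\le r_0$. Standing assumptions: (i) as $t\to\infty$, $f(r,\varphi,S,t)\sim\sum_{k=1}^\infty t^{-k/q}f_k(r,\varphi,S)$ and $g(r,\varphi,S,t)\sim\sum_{k=1}^\infty t^{-k/q}g_k(r,\varphi,S)$ for all $|r|\le r_0$, $(\varphi,S)\in\mathbb R^2$, where $f_k,g_k$ are $2\pi$-periodic in $\varphi$ and $S$ and their Fourier series $f_k=\sum_{(k_1,k_2)\in\mathbb Z^2}f_{k,k_1,k_2}(r)e^{i(k_1\varphi+k_2S)}$, $g_k=\sum_{(k_1,k_2)\in\mathbb Z^2}g_{k,k_1,k_2}(r)e^{i(k_1\varphi+k_2S)}$ contain a finite number of harmonics $e^{ik_2S}$; (ii) there is $p\in\mathbb Z_+$ such that $|f_k(r,\varphi,S)|+|g_k(r,\varphi,S)|=\mathcal O(r)$ as $r\to0$ for $k<p$, and $f_{p,0,0}(0)\ne0$; (iii) $S(t)=s_0t+\sum_{k=1}^{q-1}s_kt^{1-k/q}+s_q\log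 t$ with real constants $s_k$, $s_0>0$; (iv) (non-resonance) $k_1\omega(0)+k_2s_0\ne0$ for all $k_1,k_2\in\mathbb Z$ with $|k_1|+|k_2|\ne0$. The functions $\Lambda_k$: fix an integer $N\in[p,2p)$. Let $\langle Z\rangle_{\varphi,S}=(2\pi)^{-2}\int_0^{2\pi}\int_0^{2\pi}Z\,d\varphi\,dS$. Write $S'(t)=s_0+\sum_{i=1}^q\sigma_it^{-i/q}$, i.e. $\sigma_i=(1-i/q)s_i$ for $i<q$, $\sigma_q=s_q$, and $\sigma_i=0$ for $i>q$; put $v_i\equiv0$ for $i<1$ or $i>N$. For $k=1,\dots,N$ define successively $$\mathcal R_k=[\epsilon^k]\sum_{j\ge1}\epsilon^j\Big(\Lambda_j\big(r+\sum_{i\ge1}\epsilon^iv_i\big)-\Lambda_j(r)\Big)-\Big(1-\frac kq\Big)v_{k-q}-\sum_{i+j=k,\ i,j\ge1}\Big(f_i\partial_r+r^{-1}g_i\partial_\varphi+\sigma_i\partial_S\Big)v_j,$$ where $[\epsilon^k]$ is the coefficient of $\epsilon^k$ in the formal Taylor expansion (so $\mathcal R_k$ depends only on $\Lambda_j,v_j$ with $j<k$), $\Lambda_k(r)=\langle f_k-\mathcal R_k\rangle_{\varphi,S}$, and $v_k(r,\varphi,S)$ is the $2\pi$-periodic zero-mean solution of $(\omega(r)\partial_\varphi+s_0\partial_S)v_k=\Lambda_k-f_k+\mathcal R_k$ obtained by dividing the Fourier coefficients of the right-hand side by $i(k_1\omega(r)+k_2s_0)$. Here $|r|\le r_\ast$,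 where $r_\ast\in(0,r_0)$ is chosen so that $k_1\omega(r)+k_2s_0\ne0$ for $|r|\le r_\ast$, all $k_1\in\mathbb Z$ and all $k_2$ in the finite set of $S$-frequencies that occur, $|k_1|+|k_2|\ne0$. Set $\Lambda_N(\rho,t)=\sum_{k=1}^Nt^{-k/q}\Lambda_k(\rho)$. The number $t_\ast>0$ is fixed so large that $(r,\varphi,t)\mapsto(V_N,\varphi,t)$, $V_N=r+\sum_{k=1}^Nt^{-k/q}v_k(r,\varphi,S(t))$, is an invertible near-identity change of variables for $|r|\le r_\ast$, $\varphi\in\mathbb R$, $t\ge t_\ast$. *)

theory Defs
  imports "HOL-Analysis.Analysis" "HOL-Computational_Algebra.Computational_Algebra"
    "HOL-Library.Landau_Symbols"
begin

text \<open>Derivatives are taken within \<open>A\<close>, so smoothness on a closed strip is smoothness up to the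
  boundary. On the sets used below (strips with nonempty interior) the partial derivatives \<open>D b\<close>
  are uniquely determined on \<open>A\<close>.\<close>

primrec Ck_on :: "nat \<Rightarrow> ('a::euclidean_space \<Rightarrow> real) \<Rightarrow> 'a set \<Rightarrow> bool" where
  "Ck_on 0 h A \<longleftrightarrow> continuous_on A h"
| "Ck_on (Suc m) h A \<longleftrightarrow>
     (\<exists>D. (\<forall>x\<in>A. (h has_derivative (\<lambda>u. \<Sum>b\<in>Basis. (u \<bullet> b) * D b x)) (at x within A)) \<and>
          (\<forall>b\<in>Basis. Ck_on m (D b) A))"

definition smooth_on :: "('a::euclidean_space \<Rightarrow> real) \<Rightarrow> 'a set \<Rightarrow> bool" where
  "smooth_on h A \<longleftrightarrow> (\<forall>m. Ck_on m h A)"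

definition smooth_strip :: "real \<Rightarrow> (real \<Rightarrow> real \<Rightarrow> real \<Rightarrow> real) \<Rightarrow> bool" where
  "smooth_strip a h \<longleftrightarrow> smooth_on (\<lambda>(r, \<phi>, S). h r \<phi> S) {(r, \<phi>, S). \<bar>r\<bar> \<le> a}"

definition smooth_strip_time :: "real \<Rightarrow> (real \<Rightarrow> real \<Rightarrow> real \<Rightarrow> real \<Rightarrow> real) \<Rightarrow> bool" where
  "smooth_strip_time a h \<longleftrightarrow>
     smooth_on (\<lambda>(r, \<phi>, S, t). h r \<phi> S t) {(r, \<phi>, S, t). \<bar>r\<bar> \<le> a \<and> 0 < t}"

definition periodic2 :: "(real \<Rightarrow> real \<Rightarrow> real) \<Rightarrow> bool" where
  "periodic2 Z \<longleftrightarrow> (\<forall>\<phi> S. Z (\<phi> + 2 * pi) S = Z \<phi> S \<and> Z \<phi> (S + 2 * pi) = Z \<phi> S)"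

definition torus_mean :: "(real \<Rightarrow> real \<Rightarrow> real) \<Rightarrow> real" where
  "torus_mean Z =
     integral {0..2 * pi} (\<lambda>S. integral {0..2 * pi} (\<lambda>\<phi>. Z \<phi> S)) / (2 * pi)\<^sup>2"

definition fourier_coeff :: "(real \<Rightarrow> real \<Rightarrow> real) \<Rightarrow> int \<Rightarrow> int \<Rightarrow> complex" where
  "fourier_coeff Z k1 k2 =
     integral {0..2 * pi} (\<lambda>S. integral {0..2 * pi}
       (\<lambda>\<phi>. complex_of_real (Z \<phi> S) * exp (- \<i> * (of_int k1 * of_real \<phi> + of_int k2 * of_real S))))
     / of_real ((2 * pi)\<^sup>2)"

definition S_frequencies :: "real \<Rightarrow> (real \<Rightarrow> real \<Rightarrow> real \<Rightarrow> real) \<Rightarrow> int set" where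
  "S_frequencies a h = {k2. \<exists>k1 r. \<bar>r\<bar> \<le> a \<and> fourier_coeff (h r) k1 k2 \<noteq> 0}"

text \<open>Asymptotic expansion in powers of \<open>t powr (- 1 / q)\<close>, uniform in \<open>\<bar>r\<bar> \<le> a\<close>, \<open>\<phi>\<close> and \<open>S\<close>.\<close>

definition has_asymptotic_series ::
  "real \<Rightarrow> nat \<Rightarrow> (real \<Rightarrow> real \<Rightarrow> real \<Rightarrow> real \<Rightarrow> real) \<Rightarrow> (nat \<Rightarrow> real \<Rightarrow> real \<Rightarrow> real \<Rightarrow> real) \<Rightarrow> bool" where
  "has_asymptotic_series a q h hc \<longleftrightarrow>
     (\<forall>K. \<forall>e>0. eventually (\<lambda>t. \<forall>r \<phi> S. \<bar>r\<bar> \<le> a \<longrightarrow>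
        \<bar>h r \<phi> S t - (\<Sum>k=1..K. t powr (- (real k / real q)) * hc k r \<phi> S)\<bar>
          \<le> e * t powr (- (real K / real q))) at_top)"

definition phase :: "nat \<Rightarrow> (nat \<Rightarrow> real) \<Rightarrow> real \<Rightarrow> real" where
  "phase q s t =
     s 0 * t + (\<Sum>k=1..<q. s k * t powr (1 - real k / real q)) + s q * ln t"

definition phase_deriv_coeff :: "nat \<Rightarrow> (nat \<Rightarrow> real) \<Rightarrow> nat \<Rightarrow> real" where
  "phase_deriv_coeff q s i =
     (if i < q then (1 - real i / real q) * s i else if i = q then s q else 0)"

definition solves_perturbed_system ::
  "real \<Rightarrow> (real \<Rightarrow> real) \<Rightarrow> (real \<Rightarrow> real \<Rightarrow> real \<Rightarrow> real \<Rightarrow> real) \<Rightarrow>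
   (real \<Rightarrow> real \<Rightarrow> real \<Rightarrow> real \<Rightarrow> real) \<Rightarrow> (real \<Rightarrow> real) \<Rightarrow>
   real set \<Rightarrow> (real \<Rightarrow> real) \<Rightarrow> (real \<Rightarrow> real) \<Rightarrow> bool" where
  "solves_perturbed_system r0 \<omega> f g S I r \<phi> \<longleftrightarrow>
     (\<forall>t\<in>I. r t \<noteq> 0 \<and> \<bar>r t\<bar> \<le> r0 \<and>
        (r has_real_derivative f (r t) (\<phi> t) (S t) t) (at t within I) \<and>
        (\<phi> has_real_derivative \<omega> (r t) + g (r t) (\<phi> t) (S t) t / r t) (at t within I))"

definition deriv_within :: "real \<Rightarrow> (real \<Rightarrow> real) \<Rightarrow> real \<Rightarrow> real" where
  "deriv_within a h r = vector_derivative h (at r within {-a..a})"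

definition taylor_coeff :: "real \<Rightarrow> (real \<Rightarrow> real) \<Rightarrow> real \<Rightarrow> nat \<Rightarrow> real" where
  "taylor_coeff a h r m = (deriv_within a ^^ m) h r / fact m"

text \<open>Division by \<open>r\<close>, with the value at \<open>r = 0\<close> given by continuity. In the recursion it is applied
  to products \<open>g\<^sub>i \<cdot> \<partial>v\<^sub>j / \<partial>\<phi>\<close> with \<open>i + j < 2 p\<close>; one of the factors is \<open>O(r)\<close>, so the singularity
  at \<open>r = 0\<close> is removable.\<close>

definition radial_quotient :: "(real \<Rightarrow> real) \<Rightarrow> real \<Rightarrow> real" where
  "radial_quotient h r = (if r = 0 then Lim (at 0) (\<lambda>x. h x / x) else h r / r)"

text \<open>The remainder \<open>R\<^sub>k\<close>. The first summand is the coefficient of \<open>\<epsilon>\<^sup>k\<close> in the formal series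
  \<open>\<Sum>\<^sub>j \<epsilon>\<^sup>j (\<Lambda>\<^sub>j(r + \<Sum>\<^sub>i \<epsilon>\<^sup>i v\<^sub>i) - \<Lambda>\<^sub>j(r))\<close>: the terms with \<open>j \<ge> k\<close> do not contribute, and the
  subtraction removes the Taylor coefficient of order \<open>0\<close>. For \<open>k \<le> q\<close> the truncated index \<open>k - q\<close>
  is \<open>0\<close>, which is correct since \<open>v 0\<close> is required to vanish below.\<close>

definition averaging_remainder ::
  "real \<Rightarrow> nat \<Rightarrow> (nat \<Rightarrow> real) \<Rightarrow> (nat \<Rightarrow> real \<Rightarrow> real \<Rightarrow> real \<Rightarrow> real) \<Rightarrow>
   (nat \<Rightarrow> real \<Rightarrow> real \<Rightarrow> real \<Rightarrow> real) \<Rightarrow> (nat \<Rightarrow> real \<Rightarrow> real) \<Rightarrow>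
   (nat \<Rightarrow> real \<Rightarrow> real \<Rightarrow> real \<Rightarrow> real) \<Rightarrow> nat \<Rightarrow> real \<Rightarrow> real \<Rightarrow> real \<Rightarrow> real" where
  "averaging_remainder a q \<sigma> fc gc \<Lambda> v k r \<phi> S =
     fps_nth (\<Sum>j=1..<k. fps_X ^ j *
        (fps_compose (Abs_fps (taylor_coeff a (\<Lambda> j) r))
                     (Abs_fps (\<lambda>i. if i = 0 then 0 else v i r \<phi> S))
         - fps_const (\<Lambda> j r))) k
     - (1 - real k / real q) * v (k - q) r \<phi> S
     - (\<Sum>i=1..<k.
          fc i r \<phi> S * deriv_within a (\<lambda>x. v (k - i) x \<phi> S) r
          + radial_quotient (\<lambda>x. gc i x \<phi> S * deriv (\<lambda>y. v (k - i) x y S) \<phi>) r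
          + \<sigma> i * deriv (\<lambda>y. v (k - i) r \<phi> y) S)"

definition homological_rhs ::
  "real \<Rightarrow> nat \<Rightarrow> (nat \<Rightarrow> real) \<Rightarrow> (nat \<Rightarrow> real \<Rightarrow> real \<Rightarrow> real \<Rightarrow> real) \<Rightarrow>
   (nat \<Rightarrow> real \<Rightarrow> real \<Rightarrow> real \<Rightarrow> real) \<Rightarrow> (nat \<Rightarrow> real \<Rightarrow> real) \<Rightarrow>
   (nat \<Rightarrow> real \<Rightarrow> real \<Rightarrow> real \<Rightarrow> real) \<Rightarrow> nat \<Rightarrow> real \<Rightarrow> real \<Rightarrow> real \<Rightarrow> real" where
  "homological_rhs a q \<sigma> fc gc \<Lambda> v k r \<phi> S =
     \<Lambda> k r - fc k r \<phi> S + averaging_remainder a q \<sigma> fc gc \<Lambda> v k r \<phi> S"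

text \<open>\<open>\<Lambda>\<close> and \<open>v\<close> are the functions of the averaging recursion up to order \<open>N\<close> on \<open>\<bar>r\<bar> \<le> a\<close>. The
  remainder of order \<open>k\<close> only involves orders below \<open>k\<close>, and a continuous periodic function is
  determined by its Fourier coefficients, so these conditions determine \<open>\<Lambda> k\<close> and \<open>v k\<close>
  successively.\<close>

definition averaging_sequence ::
  "real \<Rightarrow> nat \<Rightarrow> nat \<Rightarrow> (real \<Rightarrow> real) \<Rightarrow> (nat \<Rightarrow> real) \<Rightarrow> (nat \<Rightarrow> real \<Rightarrow> real \<Rightarrow> real \<Rightarrow> real) \<Rightarrow>
   (nat \<Rightarrow> real \<Rightarrow> real \<Rightarrow> real \<Rightarrow> real) \<Rightarrow> (nat \<Rightarrow> real \<Rightarrow> real) \<Rightarrow>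
   (nat \<Rightarrow> real \<Rightarrow> real \<Rightarrow> real \<Rightarrow> real) \<Rightarrow> bool" where
  "averaging_sequence a q N \<omega> s fc gc \<Lambda> v \<longleftrightarrow>
     (let \<sigma> = phase_deriv_coeff q s in
      (\<forall>k. k < 1 \<or> k > N \<longrightarrow> (\<forall>r \<phi> S. v k r \<phi> S = 0)) \<and>
      (\<forall>k\<in>{1..N}. smooth_strip a (v k) \<and>
        (\<forall>r. \<bar>r\<bar> \<le> a \<longrightarrow>
           \<Lambda> k r = torus_mean (\<lambda>\<phi> S. fc k r \<phi> S - averaging_remainder a q \<sigma> fc gc \<Lambda> v k r \<phi> S) \<and>
           periodic2 (v k r) \<and>
           torus_mean (v k r) = 0 \<and>
           (\<forall>\<phi> S. \<omega> r * deriv (\<lambda>y. v k r y S) \<phi> + s 0 * deriv (\<lambda>y. v k r \<phi> y) S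
                    = homological_rhs a q \<sigma> fc gc \<Lambda> v k r \<phi> S) \<and>
           (\<forall>k1 k2. (k1, k2) \<noteq> (0, 0) \<longrightarrow>
              fourier_coeff (v k r) k1 k2 =
                fourier_coeff (homological_rhs a q \<sigma> fc gc \<Lambda> v k r) k1 k2
                / (\<i> * of_real (of_int k1 * \<omega> r + of_int k2 * s 0))))))"

definition occurring_S_frequencies ::
  "real \<Rightarrow> nat \<Rightarrow> nat \<Rightarrow> (nat \<Rightarrow> real) \<Rightarrow> (nat \<Rightarrow> real \<Rightarrow> real \<Rightarrow> real \<Rightarrow> real) \<Rightarrow>
   (nat \<Rightarrow> real \<Rightarrow> real \<Rightarrow> real \<Rightarrow> real) \<Rightarrow> (nat \<Rightarrow> real \<Rightarrow> real) \<Rightarrow>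
   (nat \<Rightarrow> real \<Rightarrow> real \<Rightarrow> real \<Rightarrow> real) \<Rightarrow> int set" where
  "occurring_S_frequencies a q N s fc gc \<Lambda> v =
     (\<Union>k\<in>{1..N}. S_frequencies a (homological_rhs a q (phase_deriv_coeff q s) fc gc \<Lambda> v k))"

definition transformed_radius ::
  "nat \<Rightarrow> nat \<Rightarrow> (real \<Rightarrow> real) \<Rightarrow> (nat \<Rightarrow> real \<Rightarrow> real \<Rightarrow> real \<Rightarrow> real) \<Rightarrow> real \<Rightarrow> real \<Rightarrow> real \<Rightarrow> real" where
  "transformed_radius q N S v r \<phi> t =
     r + (\<Sum>k=1..N. t powr (- (real k / real q)) * v k r \<phi> (S t))"

definition near_identity_change :: "real \<Rightarrow> real \<Rightarrow> (real \<Rightarrow> real \<Rightarrow> real \<Rightarrow> real) \<Rightarrow> bool" where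
  "near_identity_change a t0 V \<longleftrightarrow>
     inj_on (\<lambda>(r, \<phi>, t). (V r \<phi> t, \<phi>, t)) {(r, \<phi>, t). \<bar>r\<bar> \<le> a \<and> t0 \<le> t} \<and>
     (\<forall>r \<phi> t. \<bar>r\<bar> \<le> a \<and> t0 \<le> t \<longrightarrow> deriv_within a (\<lambda>x. V x \<phi> t) r \<noteq> 0) \<and>
     (\<forall>e>0. eventually (\<lambda>t. \<forall>r \<phi>. \<bar>r\<bar> \<le> a \<longrightarrow> \<bar>V r \<phi> t - r\<bar> < e) at_top)"

text \<open>A series \<open>\<Sum>\<^sub>k t powr (- k / q) * c\<^sub>k (ln t)\<close> with polynomial \<open>c\<^sub>k\<close> is represented by the formal
  power series with coefficients \<open>c\<^sub>k\<close>; the formal variable stands for \<open>t powr (- 1 / q)\<close>. Since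
  \<open>d/dt (t powr (- k / q) * c\<^sub>k (ln t)) = t powr (- (k + q) / q) * (c\<^sub>k' - (k / q) c\<^sub>k) (ln t)\<close>,
  the formal derivative is as follows.\<close>

definition formal_time_deriv :: "nat \<Rightarrow> real poly fps \<Rightarrow> real poly fps" where
  "formal_time_deriv q F = Abs_fps (\<lambda>m. if m < q then 0
     else pderiv (fps_nth F (m - q)) - smult (real (m - q) / real q) (fps_nth F (m - q)))"

text \<open>\<open>\<rho>\<^sub>0 + \<Sum>\<^sub>k\<^sub>\<ge>\<^sub>1 t powr (- k / q) * \<rho>\<^sub>k (ln t)\<close> formally solves
  \<open>d\<varrho>/dt = \<Sum>\<^sub>k\<^sub>=\<^sub>1\<^sup>N t powr (- k / q) * \<Lambda>\<^sub>k(\<varrho>)\<close>, each \<open>\<Lambda>\<^sub>k\<close> being expanded at \<open>\<rho>\<^sub>0\<close>.\<close>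

definition formal_solution ::
  "real \<Rightarrow> nat \<Rightarrow> nat \<Rightarrow> (nat \<Rightarrow> real \<Rightarrow> real) \<Rightarrow> real \<Rightarrow> (nat \<Rightarrow> real poly) \<Rightarrow> bool" where
  "formal_solution a q N \<Lambda> \<rho>0 \<rho> \<longleftrightarrow>
     formal_time_deriv q (Abs_fps (\<lambda>k. if k = 0 then [:\<rho>0:] else \<rho> k)) =
     (\<Sum>k=1..N. fps_X ^ k *
        fps_compose (Abs_fps (\<lambda>m. [:taylor_coeff a (\<Lambda> k) \<rho>0 m:]))
                    (Abs_fps (\<lambda>k. if k = 0 then 0 else \<rho> k)))"

definition partial_sum :: "nat \<Rightarrow> real \<Rightarrow> (nat \<Rightarrow> real poly) \<Rightarrow> nat \<Rightarrow> real \<Rightarrow> real" where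
  "partial_sum q \<rho>0 \<rho> M t =
     \<rho>0 + (\<Sum>k=1..M. t powr (- (real k / real q)) * poly (\<rho> k) (ln t))"

end

theory Submission
  imports Defs "HOL-Real_Asymp.Real_Asymp"
begin

text \<open>Instability holds because the averaged radial drift pushes trajectories away from
  \<open>\<rho>\<^sub>0\<close> and acts for an infinite total amount of rescaled time.

  Put \<open>u = t powr (- 1 / q)\<close> and truncate the near-identity change at order \<open>p\<close>:
  \<open>W = r + \<Sum>\<^sub>k\<^sub>\<le>\<^sub>p u\<^sup>k v\<^sub>k(r, \<phi>, S(t))\<close>. Along a solution every term of order below \<open>p\<close> in \<open>dW/dt\<close>
  cancels by the homological equations, since \<open>\<Lambda>\<^sub>k\<close> vanishes for \<open>k < p\<close>. What remains is
  \<open>dW/dt = u\<^sup>p (\<Lambda>\<^sub>p(r) + o(1))\<close>, uniformly in \<open>\<phi>\<close> and in \<open>r\<close> away from \<open>0\<close>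
  (\<open>averaged_radius_rate\<close>), while \<open>W - r\<close> tends to \<open>0\<close> uniformly.

  Given \<open>\<delta>\<^sub>0\<close>, start at distance \<open>\<delta>\<^sub>0\<close> above the partial sum. The partial sum tends to \<open>\<rho>\<^sub>0\<close>, so for a
  late initial time the solution starts above \<open>\<rho>\<^sub>0 + \<delta>\<^sub>0 / 2\<close>. As \<open>\<Lambda>\<^sub>p(\<rho>\<^sub>0) = 0\<close> and \<open>\<Lambda>\<^sub>p'(\<rho>\<^sub>0) > 0\<close>,
  the function \<open>\<Lambda>\<^sub>p\<close> is bounded below by a positive constant on
  \<open>[\<rho>\<^sub>0 + \<delta>\<^sub>0 / 2, \<rho>\<^sub>0 + d]\<close>, for a \<open>d\<close> chosen before \<open>\<delta>\<^sub>0\<close>. The initial time may depend on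
  \<open>\<delta>\<^sub>0\<close>, so the \<open>o(1)\<close> term can be made smaller than this constant; then \<open>W\<close> increases at a rate
  at least \<open>c / t\<close>, because \<open>u\<^sup>p \<ge> 1 / t\<close> for \<open>p \<le> q\<close>. The integral of \<open>c / t\<close> diverges, so the
  solution must leave the interval, and it can do so only through the upper end \<open>\<rho>\<^sub>0 + d\<close>
  (\<open>first_exit_through_upper_end\<close>). There its distance from the partial sum exceeds \<open>d / 2\<close>.

  The solution itself comes from the contraction principle, applied to the system in which the
  radius is replaced by its projection to the interval; this system is globally Lipschitz
  (\<open>perturbed_system_solution_while_in_interval\<close>).\<close>

section \<open>Global solutions of Lipschitz differential equations\<close>

text \<open>The Picard operator contracts on the whole interval, however long, once curves are written as
  \<open>x\<^sub>0 + exp (2 L (t - a)) y(t)\<close> and compared in the supremum norm of \<open>y\<close>: the exponential weight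
  turns the Lipschitz constant \<open>L\<close> into the factor \<open>1 / 2\<close>.\<close>

lemma global_lipschitz_ode_solution:
  fixes F :: "real \<Rightarrow> 'a::banach \<Rightarrow> 'a"
  assumes ab: "a \<le> b" and L: "L > 0"
    and cont: "continuous_on ({a..b} \<times> UNIV) (\<lambda>(t, x). F t x)"
    and lip: "\<And>t x y. t \<in> {a..b} \<Longrightarrow> norm (F t x - F t y) \<le> L * norm (x - y)"
  shows "\<exists>x. x a = x0 \<and> (\<forall>t\<in>{a..b}. (x has_vector_derivative F t (x t)) (at t within {a..b}))"
proof -
  define w where "w t = exp (2 * L * (t - a))" for t
  have w_pos: "w t > 0" for t by (simp add: w_def)
  have w_cont: "continuous_on A w" for A
    unfolding w_def by (intro continuous_intros)
  \<comment> \<open>Bounded continuous functions live on the whole line, so curves on \<open>[a, b]\<close> are extended by constants.\<close>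
  define cl where "cl t = max a (min b t)" for t
  have cl: "cl t \<in> {a..b}" for t using ab by (auto simp: cl_def)
  have cl_id: "cl t = t" if "t \<in> {a..b}" for t using that by (auto simp: cl_def)
  have cl_cont: "continuous_on UNIV cl" unfolding cl_def by (intro continuous_intros)
  define G where "G y s = F s (x0 + w s *\<^sub>R apply_bcontfun y s)" for y s
  have G_cont: "continuous_on {a..b} (G y)" for y
  proof -
    have "continuous_on {a..b} (\<lambda>s. (s, x0 + w s *\<^sub>R apply_bcontfun y s))"
      by (intro continuous_intros w_cont continuous_on_apply_bcontfun)
    from continuous_on_compose2[OF cont this] show ?thesis by (auto simp: G_def)
  qed
  have G_int: "G y integrable_on {a..t}" if "t \<in> {a..b}" for y t
    by (rule integrable_continuous_real) (rule continuous_on_subset[OF G_cont], use that in auto)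
  define q where "q y t = (1 / w t) *\<^sub>R integral {a..t} (G y)" for y t
  have q_cont: "continuous_on {a..b} (q y)" for y
    unfolding q_def using w_pos
    by (intro continuous_intros w_cont indefinite_integral_continuous_1 G_int)
      (use ab in \<open>auto simp: less_imp_neq[symmetric]\<close>)
  define P where "P y = Bcontfun (\<lambda>t. q y (cl t))" for y
  have q_bcont: "(\<lambda>t. q y (cl t)) \<in> bcontfun" for y
  proof -
    have "continuous_on UNIV (\<lambda>t. q y (cl t))"
      by (rule continuous_on_compose2[OF q_cont cl_cont]) (use cl in auto)
    moreover have "bounded (q y ` {a..b})"
      by (intro compact_imp_bounded compact_continuous_image q_cont) auto
    then have "bounded (range (\<lambda>t. q y (cl t)))"
      by (rule bounded_subset) (use cl in auto)
    ultimately show ?thesis by (simp add: bcontfun_def)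
  qed
  have P_apply: "apply_bcontfun (P y) t = q y (cl t)" for y t
    unfolding P_def by (simp add: Bcontfun_inverse[OF q_bcont])
  have contr: "dist (P y) (P z) \<le> 1 / 2 * dist y z" for y z
  proof (rule dist_bound)
    fix u
    define t where "t = cl u"
    have t: "t \<in> {a..b}" using cl by (simp add: t_def)
    have bound: "norm (G y s - G z s) \<le> (L * dist y z) * w s" if "s \<in> {a..t}" for s
    proof -
      have "norm (G y s - G z s) \<le> L * norm (w s *\<^sub>R (apply_bcontfun y s - apply_bcontfun z s))"
        using lip[of s "x0 + w s *\<^sub>R apply_bcontfun y s" "x0 + w s *\<^sub>R apply_bcontfun z s"] that t
        unfolding G_def by (simp add: scaleR_diff_right)
      also have "\<dots> = L * (w s * dist (apply_bcontfun y s) (apply_bcontfun z s))"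
        using w_pos[of s] by (simp add: dist_norm)
      also have "\<dots> \<le> L * (w s * dist y z)"
        using L w_pos[of s] by (intro mult_left_mono dist_bounded) auto
      finally show ?thesis by (simp add: mult_ac)
    qed
    have w_int: "(w has_integral (w t / (2 * L) - w a / (2 * L))) {a..t}"
      using t L unfolding w_def
      by (intro fundamental_theorem_of_calculus)
        (auto intro!: derivative_eq_intros simp: has_real_derivative_iff_has_vector_derivative[symmetric])
    have "dist (q y t) (q z t) = (1 / w t) * norm (integral {a..t} (G y) - integral {a..t} (G z))"
      using w_pos[of t] by (simp add: q_def dist_norm flip: scaleR_diff_right)
    also have "integral {a..t} (G y) - integral {a..t} (G z) = integral {a..t} (\<lambda>s. G y s - G z s)"
      using G_int[OF t] by (simp add: integral_diff)
    also have "norm \<dots> \<le> integral {a..t} (\<lambda>s. (L * dist y z) * w s)"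
      by (rule integral_norm_bound_integral)
        (use bound t w_int in \<open>auto intro!: integrable_diff G_int integrable_on_mult_right\<close>)
    also have "\<dots> = (L * dist y z) * (w t / (2 * L) - w a / (2 * L))"
      using w_int by (simp add: integral_unique)
    also have "\<dots> \<le> (L * dist y z) * (w t / (2 * L))"
      using L w_pos[of a] by (intro mult_left_mono) auto
    finally have "dist (q y t) (q z t) \<le> (1 / w t) * ((L * dist y z) * (w t / (2 * L)))"
      using w_pos[of t] by (simp add: divide_right_mono)
    also have "\<dots> = 1 / 2 * dist y z" using w_pos[of t] L by (simp add: field_simps)
    finally show "dist (apply_bcontfun (P y) u) (apply_bcontfun (P z) u) \<le> 1 / 2 * dist y z"
      by (simp add: P_apply t_def)
  qed
  \<comment> \<open>The fixed point solves the integral equation for \<open>x = x\<^sub>0 + w y\<close>.\<close>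
  obtain y where y: "P y = y"
    using banach_fix_type[of "1/2" P] contr by auto
  have fix_eq: "w t *\<^sub>R apply_bcontfun y t = integral {a..t} (G y)" if "t \<in> {a..b}" for t
  proof -
    have "apply_bcontfun y t = q y t" using P_apply[of y t] y cl_id[OF that] by simp
    then show ?thesis using w_pos[of t] by (simp add: q_def)
  qed
  define x where "x t = x0 + integral {a..t} (G y)" for t
  show ?thesis
  proof (intro exI[of _ x] conjI ballI)
    show "x a = x0" by (simp add: x_def)
    fix t assume t: "t \<in> {a..b}"
    have "(x has_vector_derivative G y t) (at t within {a..b})"
      unfolding x_def
      by (auto intro!: derivative_eq_intros integral_has_vector_derivative G_cont t)
    moreover have "G y t = F t (x t)" using fix_eq[OF t] by (simp add: G_def x_def)
    ultimately show "(x has_vector_derivative F t (x t)) (at t within {a..b})" by simp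
  qed
qed

section \<open>Periodic functions with continuous partial derivatives\<close>

text \<open>The first-order content of \<^const>\<open>smooth_on\<close>; the partial derivatives are carried
  explicitly so that they can be bounded.\<close>

definition has_partials :: "('a::euclidean_space \<Rightarrow> real) \<Rightarrow> ('a \<Rightarrow> 'a \<Rightarrow> real) \<Rightarrow> 'a set \<Rightarrow> bool" where
  "has_partials h D A \<longleftrightarrow>
     (\<forall>x\<in>A. (h has_derivative (\<lambda>u. \<Sum>b\<in>Basis. (u \<bullet> b) * D b x)) (at x within A)) \<and>
     (\<forall>b\<in>Basis. continuous_on A (D b))"

lemma smooth_on_has_partials:
  assumes "smooth_on h A"
  obtains D where "has_partials h D A"
proof -
  have "Ck_on (Suc 0) h A" using assms by (simp add: smooth_on_def)
  then show thesis using that by (auto simp: has_partials_def)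
qed

lemma has_partials_continuous_on: "has_partials h D A \<Longrightarrow> continuous_on A h"
  unfolding has_partials_def continuous_on_eq_continuous_within
  by (blast intro: has_derivative_continuous)

lemma has_partials_lipschitz:
  fixes h :: "'a::euclidean_space \<Rightarrow> real" and B :: real
  assumes D: "has_partials h D A" and C: "convex C" "C \<subseteq> A"
    and B: "\<And>b x. b \<in> Basis \<Longrightarrow> x \<in> C \<Longrightarrow> \<bar>D b x\<bar> \<le> B"
    and xy: "x \<in> C" "y \<in> C"
  shows "\<bar>h x - h y\<bar> \<le> DIM('a) * B * norm (x - y)"
proof -
  have "norm (h x - h y) \<le> (DIM('a) * B) * norm (x - y)"
  proof (rule differentiable_bound[OF C(1) _ _ xy])
    fix z assume z: "z \<in> C"
    show "(h has_derivative (\<lambda>u. \<Sum>b\<in>Basis. (u \<bullet> b) * D b z)) (at z within C)"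
      using D z C(2) by (auto simp: has_partials_def intro: has_derivative_subset)
    show "onorm (\<lambda>u. \<Sum>b\<in>Basis. (u \<bullet> b) * D b z) \<le> DIM('a) * B"
    proof (rule onorm_le)
      fix u
      have "norm (\<Sum>b\<in>Basis. (u \<bullet> b) * D b z) \<le> (\<Sum>b::'a\<in>Basis. B * norm u)"
      proof (rule sum_norm_le)
        fix b :: 'a assume b: "b \<in> Basis"
        show "norm ((u \<bullet> b) * D b z) \<le> B * norm u"
          using mult_mono[OF Basis_le_norm[OF b, of u] B[OF b z]]
          by (simp add: abs_mult mult.commute)
      qed
      then show "norm (\<Sum>b\<in>Basis. (u \<bullet> b) * D b z) \<le> DIM('a) * B * norm u"
        by (simp add: mult_ac)
    qed
  qed
  then show ?thesis by simp
qed

text \<open>The shifted derivative is also a derivative of the function itself, and derivatives within a set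
  are unique where the set accumulates along every coordinate direction.\<close>

lemma partials_shift_invariant:
  fixes h :: "'a::euclidean_space \<Rightarrow> real"
  assumes D: "has_partials h D A" and b: "b \<in> Basis" and x: "x \<in> A"
    and acc: "\<And>i e. i \<in> Basis \<Longrightarrow> e > 0 \<Longrightarrow> \<exists>d. 0 < \<bar>d\<bar> \<and> \<bar>d\<bar> < e \<and> x + d *\<^sub>R i \<in> A"
    and shift: "\<And>x. x \<in> A \<Longrightarrow> x + c \<in> A" "\<And>x. x \<in> A \<Longrightarrow> h (x + c) = h x"
  shows "D b (x + c) = D b x"
proof -
  let ?d = "\<lambda>x u. \<Sum>b\<in>Basis. (u \<bullet> b) * D b x"
  have "((\<lambda>x. x + c) has_derivative (\<lambda>u. u)) (at x within A)"
    by (auto intro!: derivative_eq_intros)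
  moreover have "(h has_derivative ?d (x + c)) (at (x + c) within (\<lambda>x. x + c) ` A)"
    using D x shift(1) unfolding has_partials_def by (blast intro: has_derivative_subset)
  ultimately have "((\<lambda>x. h (x + c)) has_derivative ?d (x + c)) (at x within A)"
    using has_derivative_in_compose[of "\<lambda>x. x + c"] by fastforce
  then have "(h has_derivative ?d (x + c)) (at x within A)"
    by (rule has_derivative_transform[OF x, rotated]) (simp add: shift)
  moreover have "(h has_derivative ?d x) (at x within A)"
    using D x by (simp add: has_partials_def)
  ultimately have "?d (x + c) = ?d x"
    by (rule frechet_derivative_unique_within) (use acc in auto)
  from fun_cong[OF this, of b] show ?thesis
    using b by (simp add: inner_Basis if_distrib[of "\<lambda>x. x * _"] cong: if_cong)
qed

lemma periodic2_shift:
  assumes "periodic2 Z"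
  shows "Z (\<phi> + of_int m * (2 * pi)) (S + of_int n * (2 * pi)) = Z \<phi> S"
proof -
  have 1: "Z (\<phi> + real k * (2 * pi)) S = Z \<phi> S" for k \<phi> S
  proof (induction k)
    case (Suc k)
    have "Z (\<phi> + real (Suc k) * (2 * pi)) S = Z ((\<phi> + real k * (2 * pi)) + 2 * pi) S"
      by (simp add: algebra_simps)
    then show ?case using assms Suc by (simp add: periodic2_def)
  qed simp
  have 2: "Z \<phi> (S + real k * (2 * pi)) = Z \<phi> S" for k \<phi> S
  proof (induction k)
    case (Suc k)
    have "Z \<phi> (S + real (Suc k) * (2 * pi)) = Z \<phi> ((S + real k * (2 * pi)) + 2 * pi)"
      by (simp add: algebra_simps)
    then show ?case using assms Suc by (simp add: periodic2_def)
  qed simp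
  have 3: "Z (\<phi> + of_int m * (2 * pi)) S = Z \<phi> S" for \<phi> S
    using 1[of \<phi> "nat m" S] 1[of "\<phi> + of_int m * (2 * pi)" "nat (- m)" S]
    by (cases "m \<ge> 0") (auto simp: algebra_simps)
  have 4: "Z \<phi> (S + of_int n * (2 * pi)) = Z \<phi> S" for \<phi> S
    using 2[of \<phi> S "nat n"] 2[of \<phi> "S + of_int n * (2 * pi)" "nat (- n)"]
    by (cases "n \<ge> 0") (auto simp: algebra_simps)
  show ?thesis by (simp add: 3 4)
qed

text \<open>The reduced point is the same for all periodic functions; this lets bounds on a compact period
  cell be transported to the whole plane.\<close>

lemma periodic2_reduce:
  obtains \<phi>' S' where "\<phi>' \<in> {0..2 * pi}" "S' \<in> {0..2 * pi}" "\<And>Z. periodic2 Z \<Longrightarrow> Z \<phi> S = Z \<phi>' S'"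
proof -
  define r where "r x = x + of_int (- \<lfloor>x / (2 * pi)\<rfloor>) * (2 * pi)" for x
  have r: "r x \<in> {0..2 * pi}" for x
  proof -
    show ?thesis
      using floor_divide_lower[of "2 * pi" x] floor_divide_upper[of "2 * pi" x]
      by (simp add: r_def algebra_simps)
  qed
  show thesis
    by (rule that[OF r r]) (simp add: r_def periodic2_shift del: of_int_minus)
qed

lemma periodic_strip_bounded:
  fixes h :: "real \<Rightarrow> real \<Rightarrow> real \<Rightarrow> real"
  assumes cont: "continuous_on {(r, \<phi>, S). \<bar>r\<bar> \<le> a} (\<lambda>(r, \<phi>, S). h r \<phi> S)"
    and per: "\<And>r. \<bar>r\<bar> \<le> a \<Longrightarrow> periodic2 (h r)"
  obtains B where "\<And>r \<phi> S. \<bar>r\<bar> \<le> a \<Longrightarrow> \<bar>h r \<phi> S\<bar> \<le> B"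
proof -
  let ?K = "{-a..a} \<times> {0..2 * pi} \<times> {0..2 * pi}"
  have "compact ((\<lambda>(r, \<phi>, S). h r \<phi> S) ` ?K)"
    by (intro compact_continuous_image continuous_on_subset[OF cont] compact_Times compact_Icc) auto
  then obtain B where B: "\<forall>x\<in>?K. \<bar>(\<lambda>(r, \<phi>, S). h r \<phi> S) x\<bar> \<le> B"
    by (auto dest!: compact_imp_bounded simp: bounded_iff)
  show thesis
  proof
    fix r \<phi> S :: real assume r: "\<bar>r\<bar> \<le> a"
    obtain \<phi>' S' where *: "\<phi>' \<in> {0..2 * pi}" "S' \<in> {0..2 * pi}" "\<And>Z. periodic2 Z \<Longrightarrow> Z \<phi> S = Z \<phi>' S'"
      using periodic2_reduce[of \<phi> S] by blast
    show "\<bar>h r \<phi> S\<bar> \<le> B" using *(3)[OF per[OF r]] B[rule_format, of "(r, \<phi>', S')"] * r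
      by (auto simp: abs_le_iff)
  qed
qed

lemma periodic_strip_time_bounded:
  fixes h :: "real \<Rightarrow> real \<Rightarrow> real \<Rightarrow> real \<Rightarrow> real"
  assumes cont: "continuous_on {(r, \<phi>, S, t). \<bar>r\<bar> \<le> a \<and> 0 < t} (\<lambda>(r, \<phi>, S, t). h r \<phi> S t)"
    and per: "\<And>r t. \<bar>r\<bar> \<le> a \<Longrightarrow> 0 < t \<Longrightarrow> periodic2 (\<lambda>\<phi> S. h r \<phi> S t)"
    and t1: "0 < t1"
  obtains B where "\<And>r \<phi> S t. \<bar>r\<bar> \<le> a \<Longrightarrow> t \<in> {t1..t2} \<Longrightarrow> \<bar>h r \<phi> S t\<bar> \<le> B"
proof -
  let ?K = "{-a..a} \<times> {0..2 * pi} \<times> {0..2 * pi} \<times> {t1..t2}"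
  have "compact ((\<lambda>(r, \<phi>, S, t). h r \<phi> S t) ` ?K)"
    by (intro compact_continuous_image continuous_on_subset[OF cont] compact_Times compact_Icc)
      (use t1 in auto)
  then obtain B where B: "\<forall>x\<in>?K. \<bar>(\<lambda>(r, \<phi>, S, t). h r \<phi> S t) x\<bar> \<le> B"
    by (auto dest!: compact_imp_bounded simp: bounded_iff)
  show thesis
  proof
    fix r \<phi> S t :: real assume r: "\<bar>r\<bar> \<le> a" and t: "t \<in> {t1..t2}"
    obtain \<phi>' S' where *: "\<phi>' \<in> {0..2 * pi}" "S' \<in> {0..2 * pi}" "\<And>Z. periodic2 Z \<Longrightarrow> Z \<phi> S = Z \<phi>' S'"
      using periodic2_reduce[of \<phi> S] by blast
    have "h r \<phi> S t = h r \<phi>' S' t" using *(3)[OF per[OF r, of t]] t t1 by auto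
    then show "\<bar>h r \<phi> S t\<bar> \<le> B" using B[rule_format, of "(r, \<phi>', S', t)"] * r t
      by (auto simp: abs_le_iff)
  qed
qed

lemma nonzero_shift_within_interval:
  fixes r a e :: real
  assumes "\<bar>r\<bar> \<le> a" "0 < a" "0 < e"
  obtains d where "0 < \<bar>d\<bar>" "\<bar>d\<bar> < e" "\<bar>r + d\<bar> \<le> a"
proof -
  have "0 < \<bar>if r \<ge> 0 then - min (e/2) a else min (e/2) a\<bar> \<and>
      \<bar>if r \<ge> 0 then - min (e/2) a else min (e/2) a\<bar> < e \<and>
      \<bar>r + (if r \<ge> 0 then - min (e/2) a else min (e/2) a)\<bar> \<le> a"
    using assms by (auto simp: min_def)
  then show thesis using that by blast
qed

text \<open>Periodicity in both angles makes up for the missing compactness of the strip: the partial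
  derivatives are bounded on a slab over a compact time interval.\<close>

lemma smooth_strip_time_lipschitz:
  fixes h :: "real \<Rightarrow> real \<Rightarrow> real \<Rightarrow> real \<Rightarrow> real"
  assumes a: "a > 0" and sm: "smooth_strip_time a h"
    and per: "\<And>r t. \<bar>r\<bar> \<le> a \<Longrightarrow> 0 < t \<Longrightarrow> periodic2 (\<lambda>\<phi> S. h r \<phi> S t)"
    and t1: "0 < t1"
  obtains B where "B \<ge> 0" "\<And>r \<phi> S t. \<bar>r\<bar> \<le> a \<Longrightarrow> t \<in> {t1..t2} \<Longrightarrow> \<bar>h r \<phi> S t\<bar> \<le> B"
    "\<And>r \<phi> r' \<phi>' S t. \<bar>r\<bar> \<le> a \<Longrightarrow> \<bar>r'\<bar> \<le> a \<Longrightarrow> t \<in> {t1..t2} \<Longrightarrow>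
        \<bar>h r \<phi> S t - h r' \<phi>' S t\<bar> \<le> B * (\<bar>r - r'\<bar> + \<bar>\<phi> - \<phi>'\<bar>)"
proof -
  let ?A = "{(r::real, \<phi>::real, S::real, t::real). \<bar>r\<bar> \<le> a \<and> 0 < t}"
  let ?h = "\<lambda>(r, \<phi>, S, t). h r \<phi> S t"
  obtain D where D: "has_partials ?h D ?A"
    using sm smooth_on_has_partials unfolding smooth_strip_time_def by blast
  \<comment> \<open>This makes derivatives within the strip unique, also on its boundary.\<close>
  have acc: "\<exists>d. 0 < \<bar>d\<bar> \<and> \<bar>d\<bar> < e \<and> x + d *\<^sub>R i \<in> ?A"
    if x: "x \<in> ?A" and i: "i \<in> Basis" and e: "e > 0" for x i e
  proof -
    obtain r \<phi> S t where x_eq: "x = (r, \<phi>, S, t)" by (cases x)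
    then have rt: "\<bar>r\<bar> \<le> a" "0 < t" using x by auto
    obtain d where d: "0 < \<bar>d\<bar>" "\<bar>d\<bar> < e" "\<bar>r + d\<bar> \<le> a"
      by (rule nonzero_shift_within_interval[OF rt(1) a e])
    from i consider "i = (1, 0, 0, 0)" | "i = (0, 1, 0, 0)" | "i = (0, 0, 1, 0)" | "i = (0, 0, 0, 1)"
      by (auto simp: Basis_prod_def zero_prod_def)
    then show ?thesis
    proof cases
      case 1 then show ?thesis using d rt by (intro exI[of _ d]) (auto simp: x_eq)
    next
      case 2 then show ?thesis using e rt by (intro exI[of _ "e/2"]) (auto simp: x_eq)
    next
      case 3 then show ?thesis using e rt by (intro exI[of _ "e/2"]) (auto simp: x_eq)
    next
      case 4 then show ?thesis using e rt by (intro exI[of _ "e/2"]) (auto simp: x_eq)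
    qed
  qed
  have bd: "\<exists>B. \<forall>r \<phi> S t. \<bar>r\<bar> \<le> a \<longrightarrow> t \<in> {t1..t2} \<longrightarrow> \<bar>D b (r, \<phi>, S, t)\<bar> \<le> B" if b: "b \<in> Basis" for b
  proof -
    have "continuous_on ?A (\<lambda>(r, \<phi>, S, t). D b (r, \<phi>, S, t))"
      using D b by (simp add: has_partials_def)
    moreover have "periodic2 (\<lambda>\<phi> S. D b (r, \<phi>, S, t))" if rt: "\<bar>r\<bar> \<le> a" "0 < t" for r t
      unfolding periodic2_def
    proof (intro allI conjI)
      fix \<phi> S
      have x: "(r, \<phi>, S, t) \<in> ?A" using rt by auto
      show "D b (r, \<phi> + 2 * pi, S, t) = D b (r, \<phi>, S, t)"
        using partials_shift_invariant[OF D b x acc[OF x], of "(0, 2 * pi, 0, 0)"] per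
        by (auto simp: periodic2_def)
      show "D b (r, \<phi>, S + 2 * pi, t) = D b (r, \<phi>, S, t)"
        using partials_shift_invariant[OF D b x acc[OF x], of "(0, 0, 2 * pi, 0)"] per
        by (auto simp: periodic2_def)
    qed
    ultimately show ?thesis
      using periodic_strip_time_bounded[of a "\<lambda>r \<phi> S t. D b (r, \<phi>, S, t)" t1 t2] t1 by metis
  qed
  then obtain Bd where Bd: "\<And>b r \<phi> S t. b \<in> Basis \<Longrightarrow> \<bar>r\<bar> \<le> a \<Longrightarrow> t \<in> {t1..t2} \<Longrightarrow> \<bar>D b (r, \<phi>, S, t)\<bar> \<le> Bd b"
    by metis
  obtain B0 where B0: "\<And>r \<phi> S t. \<bar>r\<bar> \<le> a \<Longrightarrow> t \<in> {t1..t2} \<Longrightarrow> \<bar>h r \<phi> S t\<bar> \<le> B0"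
    using periodic_strip_time_bounded[OF has_partials_continuous_on[OF D] per t1, of t2] by blast
  define B1 where "B1 = (\<Sum>b\<in>Basis. \<bar>Bd b\<bar>)"
  have B1: "\<bar>D b (r, \<phi>, S, t)\<bar> \<le> B1" if "b \<in> Basis" "\<bar>r\<bar> \<le> a" "t \<in> {t1..t2}" for b r \<phi> S t
    using Bd[OF that, of \<phi> S] member_le_sum[of b Basis "\<lambda>b. \<bar>Bd b\<bar>"] that(1) by (auto simp: B1_def)
  have B1_nonneg: "B1 \<ge> 0" by (simp add: B1_def sum_nonneg)
  let ?C = "{-a..a} \<times> (UNIV :: real set) \<times> (UNIV :: real set) \<times> {t1..t2}"
  have C: "convex ?C" by (intro convex_Times) auto
  have CA: "?C \<subseteq> ?A" using t1 by auto
  show thesis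
  proof (rule that[of "\<bar>B0\<bar> + 4 * B1"])
    show "\<bar>B0\<bar> + 4 * B1 \<ge> 0" using B1_nonneg by simp
    fix r \<phi> S t assume "\<bar>r\<bar> \<le> a" "t \<in> {t1..t2}"
    then show "\<bar>h r \<phi> S t\<bar> \<le> \<bar>B0\<bar> + 4 * B1" using B0[of r t \<phi> S] B1_nonneg by linarith
  next
    fix r \<phi> r' \<phi>' S t assume *: "\<bar>r\<bar> \<le> a" "\<bar>r'\<bar> \<le> a" "t \<in> {t1..t2}"
    have "\<bar>?h (r, \<phi>, S, t) - ?h (r', \<phi>', S, t)\<bar>
        \<le> DIM(real \<times> real \<times> real \<times> real) * B1 * norm ((r, \<phi>, S, t) - (r', \<phi>', S, t))"
      using has_partials_lipschitz[OF D C CA, of B1 "(r, \<phi>, S, t)" "(r', \<phi>', S, t)"] B1 *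
      by (auto simp: abs_le_iff)
    also have "\<dots> = 4 * B1 * norm (r - r', \<phi> - \<phi>')" by (simp add: norm_Pair)
    also have "\<dots> \<le> (\<bar>B0\<bar> + 4 * B1) * (\<bar>r - r'\<bar> + \<bar>\<phi> - \<phi>'\<bar>)"
      using norm_Pair_le[of "r - r'" "\<phi> - \<phi>'"] B1_nonneg by (intro mult_mono) auto
    finally show "\<bar>h r \<phi> S t - h r' \<phi>' S t\<bar> \<le> (\<bar>B0\<bar> + 4 * B1) * (\<bar>r - r'\<bar> + \<bar>\<phi> - \<phi>'\<bar>)" by simp
  qed
qed

text \<open>Identifies the abstract partial derivatives with the one-variable derivatives that occur in the
  averaging recursion, which is possible because derivatives within the strip are unique.\<close>

lemma smooth_periodic_strip_partials:
  fixes h :: "real \<Rightarrow> real \<Rightarrow> real \<Rightarrow> real"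
  assumes a: "a > 0" and sm: "smooth_strip a h"
    and per: "\<And>r. \<bar>r\<bar> \<le> a \<Longrightarrow> periodic2 (h r)"
  shows "\<And>r \<phi> S. \<bar>r\<bar> \<le> a \<Longrightarrow>
      ((\<lambda>(r, \<phi>, S). h r \<phi> S) has_derivative
        (\<lambda>(x, y, z). x * deriv_within a (\<lambda>x. h x \<phi> S) r + y * deriv (\<lambda>y. h r y S) \<phi>
                     + z * deriv (\<lambda>y. h r \<phi> y) S)) (at (r, \<phi>, S) within {(r, \<phi>, S). \<bar>r\<bar> \<le> a})"
      (is "\<And>r \<phi> S. _ \<Longrightarrow> ?Der r \<phi> S")
    and "\<exists>B. \<forall>r \<phi> S. \<bar>r\<bar> \<le> a \<longrightarrow> \<bar>h r \<phi> S\<bar> \<le> B \<and> \<bar>deriv_within a (\<lambda>x. h x \<phi> S) r\<bar> \<le> B \<and>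
        \<bar>deriv (\<lambda>y. h r y S) \<phi>\<bar> \<le> B \<and> \<bar>deriv (\<lambda>y. h r \<phi> y) S\<bar> \<le> B"
proof -
  let ?A = "{(r::real, \<phi>::real, S::real). \<bar>r\<bar> \<le> a}"
  let ?h = "\<lambda>(r, \<phi>, S). h r \<phi> S"
  obtain D where D: "has_partials ?h D ?A"
    using sm smooth_on_has_partials unfolding smooth_strip_def by blast
  \<comment> \<open>This makes derivatives within the strip unique, also on its boundary.\<close>
  have acc: "\<exists>d. 0 < \<bar>d\<bar> \<and> \<bar>d\<bar> < e \<and> x + d *\<^sub>R i \<in> ?A"
    if x: "x \<in> ?A" and i: "i \<in> Basis" and e: "e > 0" for x i e
  proof -
    obtain r \<phi> S where x_eq: "x = (r, \<phi>, S)" by (cases x)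
    then have r: "\<bar>r\<bar> \<le> a" using x by auto
    obtain d where d: "0 < \<bar>d\<bar>" "\<bar>d\<bar> < e" "\<bar>r + d\<bar> \<le> a"
      by (rule nonzero_shift_within_interval[OF r a e])
    from i consider "i = (1, 0, 0)" | "i = (0, 1, 0)" | "i = (0, 0, 1)"
      by (auto simp: Basis_prod_def zero_prod_def)
    then show ?thesis
    proof cases
      case 1 then show ?thesis using d r by (intro exI[of _ d]) (auto simp: x_eq)
    next
      case 2 then show ?thesis using e r by (intro exI[of _ "e/2"]) (auto simp: x_eq)
    next
      case 3 then show ?thesis using e r by (intro exI[of _ "e/2"]) (auto simp: x_eq)
    qed
  qed
  have der: "(?h has_derivative (\<lambda>(x, y, z). x * D (1,0,0) (r, \<phi>, S) + y * D (0,1,0) (r, \<phi>, S)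
        + z * D (0,0,1) (r, \<phi>, S))) (at (r, \<phi>, S) within ?A)" if "\<bar>r\<bar> \<le> a" for r \<phi> S
  proof -
    have "(?h has_derivative (\<lambda>u. \<Sum>b\<in>Basis. (u \<bullet> b) * D b (r, \<phi>, S))) (at (r, \<phi>, S) within ?A)"
      using D that by (auto simp: has_partials_def)
    moreover have Basis3: "Basis = {(1, 0, 0), (0, 1, 0), (0, 0, 1) :: real \<times> real \<times> real}"
      by (auto simp: Basis_prod_def zero_prod_def)
    have "(\<lambda>u. \<Sum>b\<in>Basis. (u \<bullet> b) * D b (r, \<phi>, S)) =
      (\<lambda>(x, y, z). x * D (1,0,0) (r, \<phi>, S) + y * D (0,1,0) (r, \<phi>, S) + z * D (0,0,1) (r, \<phi>, S))"
      by (auto simp: fun_eq_iff Basis3)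
    ultimately show ?thesis by simp
  qed
  have 1: "deriv_within a (\<lambda>x. h x \<phi> S) r = D (1,0,0) (r, \<phi>, S)" if r: "\<bar>r\<bar> \<le> a" for r \<phi> S
  proof -
    have "((\<lambda>x. (x, \<phi>, S)) has_derivative (\<lambda>x. (x, 0, 0))) (at r within {-a..a})"
      and "(\<lambda>x. (x, \<phi>, S)) ` {-a..a} \<subseteq> ?A"
      using r by (auto intro!: derivative_eq_intros simp: zero_prod_def)
    from has_derivative_in_compose[OF this(1) has_derivative_subset[OF der[OF r] this(2)]]
    have "((\<lambda>x. ?h (x, \<phi>, S)) has_derivative
        (\<lambda>x. (\<lambda>(x, y, z). x * D (1,0,0) (r, \<phi>, S) + y * D (0,1,0) (r, \<phi>, S)
          + z * D (0,0,1) (r, \<phi>, S)) (x, 0, 0))) (at r within {-a..a})"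
      .
    then have "((\<lambda>x. h x \<phi> S) has_vector_derivative D (1,0,0) (r, \<phi>, S)) (at r within {-a..a})"
      by (simp add: has_vector_derivative_def)
    then show ?thesis unfolding deriv_within_def
      using vector_derivative_within_cbox[of "-a" a r "\<lambda>x. h x \<phi> S"] a r by (auto simp: abs_le_iff)
  qed
  have 2: "deriv (\<lambda>y. h r y S) \<phi> = D (0,1,0) (r, \<phi>, S)" if r: "\<bar>r\<bar> \<le> a" for r \<phi> S
  proof -
    have "((\<lambda>x. (r, x, S)) has_derivative (\<lambda>x. (0, x, 0))) (at \<phi>)"
      and "range (\<lambda>x. (r, x, S)) \<subseteq> ?A"
      using r by (auto intro!: derivative_eq_intros simp: zero_prod_def)
    from has_derivative_in_compose[OF this(1) has_derivative_subset[OF der[OF r] this(2)]]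
    have "((\<lambda>x. ?h (r, x, S)) has_derivative
        (\<lambda>x. (\<lambda>(x, y, z). x * D (1,0,0) (r, \<phi>, S) + y * D (0,1,0) (r, \<phi>, S)
          + z * D (0,0,1) (r, \<phi>, S)) (0, x, 0))) (at \<phi>)"
      .
    then have "((\<lambda>x. h r x S) has_real_derivative D (0,1,0) (r, \<phi>, S)) (at \<phi>)"
      by (simp add: has_field_derivative_def mult_commute_abs)
    then show ?thesis by (rule DERIV_imp_deriv)
  qed
  have 3: "deriv (\<lambda>y. h r \<phi> y) S = D (0,0,1) (r, \<phi>, S)" if r: "\<bar>r\<bar> \<le> a" for r \<phi> S
  proof -
    have "((\<lambda>x. (r, \<phi>, x)) has_derivative (\<lambda>x. (0, 0, x))) (at S)"
      and "range (\<lambda>x. (r, \<phi>, x)) \<subseteq> ?A"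
      using r by (auto intro!: derivative_eq_intros simp: zero_prod_def)
    from has_derivative_in_compose[OF this(1) has_derivative_subset[OF der[OF r] this(2)]]
    have "((\<lambda>x. ?h (r, \<phi>, x)) has_derivative
        (\<lambda>x. (\<lambda>(x, y, z). x * D (1,0,0) (r, \<phi>, S) + y * D (0,1,0) (r, \<phi>, S)
          + z * D (0,0,1) (r, \<phi>, S)) (0, 0, x))) (at S)"
      .
    then have "((\<lambda>x. h r \<phi> x) has_real_derivative D (0,0,1) (r, \<phi>, S)) (at S)"
      by (simp add: has_field_derivative_def mult_commute_abs)
    then show ?thesis by (rule DERIV_imp_deriv)
  qed
  show "?Der r \<phi> S" if "\<bar>r\<bar> \<le> a" for r \<phi> S
    using der[OF that] by (simp add: 1[OF that] 2[OF that] 3[OF that])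
  have bd: "\<exists>B. \<forall>r \<phi> S. \<bar>r\<bar> \<le> a \<longrightarrow> \<bar>D b (r, \<phi>, S)\<bar> \<le> B" if b: "b \<in> Basis" for b
  proof -
    have "continuous_on ?A (\<lambda>(r, \<phi>, S). D b (r, \<phi>, S))"
      using D b by (simp add: has_partials_def)
    moreover have "periodic2 (\<lambda>\<phi> S. D b (r, \<phi>, S))" if r: "\<bar>r\<bar> \<le> a" for r
      unfolding periodic2_def
    proof (intro allI conjI)
      fix \<phi> S
      have x: "(r, \<phi>, S) \<in> ?A" using r by auto
      show "D b (r, \<phi> + 2 * pi, S) = D b (r, \<phi>, S)"
        using partials_shift_invariant[OF D b x acc[OF x], of "(0, 2 * pi, 0)"] per
        by (auto simp: periodic2_def)
      show "D b (r, \<phi>, S + 2 * pi) = D b (r, \<phi>, S)"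
        using partials_shift_invariant[OF D b x acc[OF x], of "(0, 0, 2 * pi)"] per
        by (auto simp: periodic2_def)
    qed
    ultimately show ?thesis
      using periodic_strip_bounded[of a "\<lambda>r \<phi> S. D b (r, \<phi>, S)"] by metis
  qed
  obtain B0 where B0: "\<And>r \<phi> S. \<bar>r\<bar> \<le> a \<Longrightarrow> \<bar>h r \<phi> S\<bar> \<le> B0"
    using periodic_strip_bounded[OF has_partials_continuous_on[OF D] per] by blast
  obtain B1 where B1: "\<And>r \<phi> S. \<bar>r\<bar> \<le> a \<Longrightarrow> \<bar>D (1,0,0) (r, \<phi>, S)\<bar> \<le> B1"
    using bd[of "(1,0,0)"] by (auto simp: Basis_prod_def zero_prod_def)
  obtain B2 where B2: "\<And>r \<phi> S. \<bar>r\<bar> \<le> a \<Longrightarrow> \<bar>D (0,1,0) (r, \<phi>, S)\<bar> \<le> B2"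
    using bd[of "(0,1,0)"] by (auto simp: Basis_prod_def zero_prod_def)
  obtain B3 where B3: "\<And>r \<phi> S. \<bar>r\<bar> \<le> a \<Longrightarrow> \<bar>D (0,0,1) (r, \<phi>, S)\<bar> \<le> B3"
    using bd[of "(0,0,1)"] by (auto simp: Basis_prod_def zero_prod_def)
  show "\<exists>B. \<forall>r \<phi> S. \<bar>r\<bar> \<le> a \<longrightarrow> \<bar>h r \<phi> S\<bar> \<le> B \<and> \<bar>deriv_within a (\<lambda>x. h x \<phi> S) r\<bar> \<le> B \<and>
        \<bar>deriv (\<lambda>y. h r y S) \<phi>\<bar> \<le> B \<and> \<bar>deriv (\<lambda>y. h r \<phi> y) S\<bar> \<le> B"
  proof (intro exI allI impI)
    fix r \<phi> S :: real assume r: "\<bar>r\<bar> \<le> a"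
    show "\<bar>h r \<phi> S\<bar> \<le> \<bar>B0\<bar> + \<bar>B1\<bar> + \<bar>B2\<bar> + \<bar>B3\<bar> \<and> \<bar>deriv_within a (\<lambda>x. h x \<phi> S) r\<bar> \<le> \<bar>B0\<bar> + \<bar>B1\<bar> + \<bar>B2\<bar> + \<bar>B3\<bar> \<and>
        \<bar>deriv (\<lambda>y. h r y S) \<phi>\<bar> \<le> \<bar>B0\<bar> + \<bar>B1\<bar> + \<bar>B2\<bar> + \<bar>B3\<bar> \<and> \<bar>deriv (\<lambda>y. h r \<phi> y) S\<bar> \<le> \<bar>B0\<bar> + \<bar>B1\<bar> + \<bar>B2\<bar> + \<bar>B3\<bar>"
      using B0[OF r, of \<phi> S] B1[OF r, of \<phi> S] B2[OF r, of \<phi> S] B3[OF r, of \<phi> S]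
      unfolding 1[OF r] 2[OF r] 3[OF r] by (intro conjI) linarith+
  qed
qed

section \<open>Solutions of the perturbed system with confined radius\<close>

lemma smooth_on_interval_lipschitz:
  fixes h :: "real \<Rightarrow> real"
  assumes sm: "smooth_on h {a..b}"
  obtains B where "B \<ge> 0" "\<And>x y. x \<in> {a..b} \<Longrightarrow> y \<in> {a..b} \<Longrightarrow> \<bar>h x - h y\<bar> \<le> B * \<bar>x - y\<bar>"
proof -
  obtain D where D: "has_partials h D {a..b}" using smooth_on_has_partials[OF sm] .
  then have "compact (D 1 ` {a..b})"
    by (intro compact_continuous_image) (auto simp: has_partials_def)
  then obtain B where B: "\<forall>x\<in>{a..b}. \<bar>D 1 x\<bar> \<le> B"
    by (auto dest!: compact_imp_bounded simp: bounded_iff)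
  show thesis
  proof (rule that[of "\<bar>B\<bar>"])
    fix x y assume "x \<in> {a..b}" "y \<in> {a..b}"
    then show "\<bar>h x - h y\<bar> \<le> \<bar>B\<bar> * \<bar>x - y\<bar>"
      using has_partials_lipschitz[OF D _ order_refl, of "\<bar>B\<bar>" x y] B by force
  qed simp
qed

lemma quotient_difference_bound:
  fixes g1 g2 x1 x2 m B :: real
  assumes m: "0 < m" "m \<le> \<bar>x1\<bar>" "m \<le> \<bar>x2\<bar>" and B: "\<bar>g2\<bar> \<le> B"
  shows "\<bar>g1 / x1 - g2 / x2\<bar> \<le> \<bar>g1 - g2\<bar> / m + B / m\<^sup>2 * \<bar>x1 - x2\<bar>"
proof -
  have nz: "x1 \<noteq> 0" "x2 \<noteq> 0" using m by auto
  have "g1 / x1 - g2 / x2 = (g1 - g2) / x1 + g2 * (x2 - x1) / (x1 * x2)"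
    using nz by (simp add: field_simps)
  then have "\<bar>g1 / x1 - g2 / x2\<bar> \<le> \<bar>(g1 - g2) / x1\<bar> + \<bar>g2 * (x2 - x1) / (x1 * x2)\<bar>"
    by linarith
  moreover have "\<bar>(g1 - g2) / x1\<bar> \<le> \<bar>g1 - g2\<bar> / m"
    using m by (simp add: frac_le)
  moreover have "m\<^sup>2 \<le> \<bar>x1\<bar> * \<bar>x2\<bar>"
    using m by (auto simp: power2_eq_square intro!: mult_mono)
  then have "\<bar>g2 * (x2 - x1) / (x1 * x2)\<bar> \<le> B * \<bar>x1 - x2\<bar> / m\<^sup>2"
    using m B nz unfolding abs_divide abs_mult
    by (intro frac_le mult_mono) (auto simp: abs_minus_commute)
  ultimately show ?thesis by simp
qed

text \<open>Projecting the radius to \<open>[r\<^sub>1, r\<^sub>2]\<close> keeps it away from the singularity at \<open>0\<close> and inside the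
  strip, so the modified system is globally Lipschitz and has a solution on the entire time interval.
  It agrees with the original system as long as the radius stays in \<open>[r\<^sub>1, r\<^sub>2]\<close>.\<close>

lemma perturbed_system_solution_while_in_interval:
  fixes f g :: "real \<Rightarrow> real \<Rightarrow> real \<Rightarrow> real \<Rightarrow> real"
  assumes r0: "r0 > 0" and sm\<omega>: "smooth_on \<omega> {-r0..r0}"
    and smf: "smooth_strip_time r0 f" and smg: "smooth_strip_time r0 g"
    and perf: "\<And>r t. \<bar>r\<bar> \<le> r0 \<Longrightarrow> t > 0 \<Longrightarrow> periodic2 (\<lambda>\<phi> S. f r \<phi> S t)"
    and perg: "\<And>r t. \<bar>r\<bar> \<le> r0 \<Longrightarrow> t > 0 \<Longrightarrow> periodic2 (\<lambda>\<phi> S. g r \<phi> S t)"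
    and S: "continuous_on {t1..t2} S" and t: "0 < t1" "t1 \<le> t2"
    and r12: "r1 \<le> r2" "{r1..r2} \<subseteq> {-r0..r0}" "0 \<notin> {r1..r2}"
  shows "\<exists>r \<phi>. r t1 = ri \<and> \<phi> t1 = \<phi>i \<and> continuous_on {t1..t2} r \<and>
    (\<forall>t\<in>{t1..t2}. r t \<in> {r1..r2} \<longrightarrow>
       (r has_real_derivative f (r t) (\<phi> t) (S t) t) (at t within {t1..t2}) \<and>
       (\<phi> has_real_derivative \<omega> (r t) + g (r t) (\<phi> t) (S t) t / r t) (at t within {t1..t2}))"
proof -
  define cl where "cl x = max r1 (min r2 x)" for x
  have cl: "cl x \<in> {r1..r2}" for x using r12 by (auto simp: cl_def)
  have cl_id: "cl x = x" if "x \<in> {r1..r2}" for x using that by (auto simp: cl_def)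
  have cl_lip: "\<bar>cl x - cl y\<bar> \<le> \<bar>x - y\<bar>" for x y
    using r12(1) by (auto simp: cl_def max_def min_def)
  have cl_cont: "continuous_on A (\<lambda>z. cl (w z))" if "continuous_on A w" for A and w :: "'b::topological_space \<Rightarrow> real"
    unfolding cl_def using that by (intro continuous_intros)
  have cl_r0: "\<bar>cl x\<bar> \<le> r0" "cl x \<in> {-r0..r0}" for x
    using cl[of x] r12(2) by (auto simp: abs_le_iff)
  \<comment> \<open>The interval does not contain \<open>0\<close>, so its distance from \<open>0\<close> is attained at an end point.\<close>
  define m where "m = min \<bar>r1\<bar> \<bar>r2\<bar>"
  have m: "m > 0" "m \<le> \<bar>cl x\<bar>" for x
    using r12 cl[of x] by (auto simp: m_def)
  obtain Bf where Bf: "Bf \<ge> 0" "\<And>r \<phi> r' \<phi>' S t. \<bar>r\<bar> \<le> r0 \<Longrightarrow> \<bar>r'\<bar> \<le> r0 \<Longrightarrow> t \<in> {t1..t2} \<Longrightarrow>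
        \<bar>f r \<phi> S t - f r' \<phi>' S t\<bar> \<le> Bf * (\<bar>r - r'\<bar> + \<bar>\<phi> - \<phi>'\<bar>)"
    using smooth_strip_time_lipschitz[OF r0 smf perf t(1), of t2] by metis
  obtain Bg where Bg: "Bg \<ge> 0" "\<And>r \<phi> S t. \<bar>r\<bar> \<le> r0 \<Longrightarrow> t \<in> {t1..t2} \<Longrightarrow> \<bar>g r \<phi> S t\<bar> \<le> Bg"
     "\<And>r \<phi> r' \<phi>' S t. \<bar>r\<bar> \<le> r0 \<Longrightarrow> \<bar>r'\<bar> \<le> r0 \<Longrightarrow> t \<in> {t1..t2} \<Longrightarrow>
        \<bar>g r \<phi> S t - g r' \<phi>' S t\<bar> \<le> Bg * (\<bar>r - r'\<bar> + \<bar>\<phi> - \<phi>'\<bar>)"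
    using smooth_strip_time_lipschitz[OF r0 smg perg t(1), of t2] by metis
  obtain B\<omega> where B\<omega>: "B\<omega> \<ge> 0"
    "\<And>x y. x \<in> {-r0..r0} \<Longrightarrow> y \<in> {-r0..r0} \<Longrightarrow> \<bar>\<omega> x - \<omega> y\<bar> \<le> B\<omega> * \<bar>x - y\<bar>"
    using smooth_on_interval_lipschitz[OF sm\<omega>] by blast
  define F where "F t z = (f (cl (fst z)) (snd z) (S t) t,
     \<omega> (cl (fst z)) + g (cl (fst z)) (snd z) (S t) t / cl (fst z))" for t and z :: "real \<times> real"
  define K where "K = Bf + (B\<omega> + (Bg / m + Bg / m\<^sup>2))"
  have K: "K \<ge> 0" using Bf(1) B\<omega>(1) Bg(1) m(1) by (simp add: K_def)
  have F_lip: "norm (F t z - F t z') \<le> (2 * K + 1) * norm (z - z')" if t': "t \<in> {t1..t2}" for t z z'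
  proof -
    obtain x y where z: "z = (x, y)" by (cases z)
    obtain x' y' where z': "z' = (x', y')" by (cases z')
    define d where "d = \<bar>x - x'\<bar> + \<bar>y - y'\<bar>"
    have d: "\<bar>cl x - cl x'\<bar> + \<bar>y - y'\<bar> \<le> d" "\<bar>cl x - cl x'\<bar> \<le> d"
      using cl_lip[of x x'] by (auto simp: d_def)
    have "\<bar>f (cl x) y (S t) t - f (cl x') y' (S t) t\<bar> \<le> Bf * d"
      using Bf(2)[OF cl_r0(1) cl_r0(1) t', of x y "S t" x' y'] mult_left_mono[OF d(1) Bf(1)] by linarith
    moreover have "\<bar>\<omega> (cl x) - \<omega> (cl x')\<bar> \<le> B\<omega> * d"
      using B\<omega>(2)[OF cl_r0(2) cl_r0(2), of x x'] mult_left_mono[OF d(2) B\<omega>(1)] by linarith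
    moreover have "\<bar>g (cl x) y (S t) t / cl x - g (cl x') y' (S t) t / cl x'\<bar> \<le> (Bg / m + Bg / m\<^sup>2) * d"
    proof -
      have "\<bar>g (cl x) y (S t) t - g (cl x') y' (S t) t\<bar> \<le> Bg * d"
        using Bg(3)[OF cl_r0(1) cl_r0(1) t', of x y "S t" x' y'] mult_left_mono[OF d(1) Bg(1)] by linarith
      then have "\<bar>g (cl x) y (S t) t - g (cl x') y' (S t) t\<bar> / m \<le> Bg / m * d"
        using m(1) by (simp add: field_simps)
      moreover have "Bg / m\<^sup>2 * \<bar>cl x - cl x'\<bar> \<le> Bg / m\<^sup>2 * d"
        using d(2) Bg(1) by (intro mult_left_mono) auto
      ultimately show ?thesis
        using quotient_difference_bound[OF m(1) m(2)[of x] m(2)[of x'] Bg(2)[OF cl_r0(1)[of x'] t'],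
            of "g (cl x) y (S t) t" y' "S t"]
        by (simp add: distrib_right)
    qed
    moreover have "norm (F t z - F t z') \<le> \<bar>f (cl x) y (S t) t - f (cl x') y' (S t) t\<bar> +
        \<bar>(\<omega> (cl x) - \<omega> (cl x')) + (g (cl x) y (S t) t / cl x - g (cl x') y' (S t) t / cl x')\<bar>"
      using norm_Pair_le[where x = "f (cl x) y (S t) t - f (cl x') y' (S t) t"
          and y = "(\<omega> (cl x) + g (cl x) y (S t) t / cl x) - (\<omega> (cl x') + g (cl x') y' (S t) t / cl x')"]
      by (simp add: F_def z z' add_diff_add)
    ultimately have "norm (F t z - F t z') \<le> K * d"
      by (simp add: K_def distrib_right)
    also have "d \<le> 2 * norm (z - z')"
      using norm_fst_le[of "x - x'" "y - y'"] norm_snd_le[of "y - y'" "x - x'"] by (simp add: d_def z z')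
    then have "K * d \<le> (2 * K) * norm (z - z')" using mult_left_mono[OF _ K] by fastforce
    also have "\<dots> \<le> (2 * K + 1) * norm (z - z')" by (intro mult_right_mono) auto
    finally show ?thesis .
  qed
  let ?A = "{(r::real, \<phi>::real, S::real, t::real). \<bar>r\<bar> \<le> r0 \<and> 0 < t}"
  obtain Df where Df: "has_partials (\<lambda>(r, \<phi>, S, t). f r \<phi> S t) Df ?A"
    using smf smooth_on_has_partials unfolding smooth_strip_time_def by blast
  obtain Dg where Dg: "has_partials (\<lambda>(r, \<phi>, S, t). g r \<phi> S t) Dg ?A"
    using smg smooth_on_has_partials unfolding smooth_strip_time_def by blast
  obtain D\<omega> where D\<omega>: "has_partials \<omega> D\<omega> {-r0..r0}" using smooth_on_has_partials[OF sm\<omega>] .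
  let ?D = "{t1..t2} \<times> (UNIV :: (real \<times> real) set)"
  have arg: "continuous_on ?D (\<lambda>(t, z). (cl (fst z), snd z, S t, t))"
    unfolding case_prod_beta
    by (intro continuous_intros cl_cont continuous_on_compose2[OF S]) auto
  have arg_in: "(\<lambda>(t, z). (cl (fst z), snd z, S t, t)) ` ?D \<subseteq> ?A" using cl_r0 t by auto
  have F_cont: "continuous_on ?D (\<lambda>(t, z). F t z)"
  proof -
    have "continuous_on ?D (\<lambda>(t, z). f (cl (fst z)) (snd z) (S t) t)"
      using continuous_on_compose2[OF has_partials_continuous_on[OF Df] arg arg_in]
      by (simp add: case_prod_beta)
    moreover have "continuous_on ?D (\<lambda>(t, z). g (cl (fst z)) (snd z) (S t) t)"
      using continuous_on_compose2[OF has_partials_continuous_on[OF Dg] arg arg_in]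
      by (simp add: case_prod_beta)
    moreover have "continuous_on ?D (\<lambda>(t, z). \<omega> (cl (fst z)))"
      unfolding case_prod_beta
      by (rule continuous_on_compose2[OF has_partials_continuous_on[OF D\<omega>]])
        (use cl_r0 in \<open>auto intro!: cl_cont continuous_on_fst continuous_on_snd continuous_on_id\<close>)
    moreover have "continuous_on ?D (\<lambda>(t, z). cl (fst z))"
      unfolding case_prod_beta by (intro continuous_intros cl_cont)
    moreover have "cl x \<noteq> 0" for x using m(1) m(2)[of x] by auto
    ultimately show ?thesis
      unfolding F_def case_prod_beta by (intro continuous_intros) auto
  qed
  have "\<exists>z. z t1 = (ri, \<phi>i) \<and>
      (\<forall>t\<in>{t1..t2}. (z has_vector_derivative F t (z t)) (at t within {t1..t2}))"
    by (rule global_lipschitz_ode_solution[OF t(2) _ F_cont F_lip]) (use K in simp_all)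
  then obtain z where z: "z t1 = (ri, \<phi>i)"
    "\<And>t. t \<in> {t1..t2} \<Longrightarrow> (z has_vector_derivative F t (z t)) (at t within {t1..t2})"
    by blast
  have dfst: "((\<lambda>t. fst (z t)) has_real_derivative fst (F t (z t))) (at t within {t1..t2})"
    if "t \<in> {t1..t2}" for t
    using bounded_linear.has_vector_derivative[OF bounded_linear_fst z(2)[OF that]]
    by (simp add: has_real_derivative_iff_has_vector_derivative)
  have dsnd: "((\<lambda>t. snd (z t)) has_real_derivative snd (F t (z t))) (at t within {t1..t2})"
    if "t \<in> {t1..t2}" for t
    using bounded_linear.has_vector_derivative[OF bounded_linear_snd z(2)[OF that]]
    by (simp add: has_real_derivative_iff_has_vector_derivative)
  show ?thesis
  proof (rule exI[of _ "\<lambda>t. fst (z t)"], rule exI[of _ "\<lambda>t. snd (z t)"], intro conjI ballI impI)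
    show "continuous_on {t1..t2} (\<lambda>t. fst (z t))"
      by (rule DERIV_continuous_on[OF dfst])
    show "fst (z t1) = ri" "snd (z t1) = \<phi>i" using z(1) by simp_all
    fix t assume t': "t \<in> {t1..t2}" and "fst (z t) \<in> {r1..r2}"
    then have cl_z: "cl (fst (z t)) = fst (z t)" using cl_id by blast
    show "((\<lambda>t. fst (z t)) has_real_derivative f (fst (z t)) (snd (z t)) (S t) t) (at t within {t1..t2})"
      using dfst[OF t'] by (simp only: F_def cl_z fst_conv)
    show "((\<lambda>t. snd (z t)) has_real_derivative
        \<omega> (fst (z t)) + g (fst (z t)) (snd (z t)) (S t) t / fst (z t)) (at t within {t1..t2})"
      using dsnd[OF t'] by (simp only: F_def cl_z snd_conv)
  qed
qed

section \<open>The drift of the averaged radius\<close>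

text \<open>Collecting the product of two truncated power series by total degree leaves over exactly the pairs
  with \<open>i + j > p\<close>, each of order \<open>u\<^sup>p\<^sup>+\<^sup>1\<close>.\<close>

lemma sum_pairs_regrouped_bound:
  fixes X :: "nat \<Rightarrow> nat \<Rightarrow> real"
  assumes X: "\<And>i j. i \<in> {1..p} \<Longrightarrow> j \<in> {1..p} \<Longrightarrow> \<bar>X i j\<bar> \<le> K" and u: "0 \<le> u" "u \<le> 1" and p: "1 \<le> p"
  shows "\<bar>(\<Sum>j=1..p. u ^ j * (\<Sum>i=1..p. u ^ i * X i j)) - (\<Sum>k=1..p. u ^ k * (\<Sum>i=1..<k. X i (k - i)))\<bar>
    \<le> real (p * p) * (u ^ (p + 1) * K)"
proof -
  let ?P = "{1..p} \<times> {1..p}"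
  let ?low = "{x \<in> ?P. fst x + snd x \<le> p}" and ?high = "{x \<in> ?P. fst x + snd x > p}"
  let ?Y = "\<lambda>x. u ^ (fst x + snd x) * X (snd x) (fst x)"
  have 1: "(\<Sum>j=1..p. u ^ j * (\<Sum>i=1..p. u ^ i * X i j)) = sum ?Y ?P"
    by (simp add: sum_distrib_left sum.cartesian_product case_prod_beta power_add mult_ac)
  have 2: "sum ?Y ?P = sum ?Y ?low + sum ?Y ?high"
  proof -
    have "sum ?Y (?low \<union> ?high) = sum ?Y ?low + sum ?Y ?high"
      by (rule sum.union_disjoint) auto
    moreover have "?low \<union> ?high = ?P" by auto
    ultimately show ?thesis by simp
  qed
  have 3: "(\<Sum>k=1..p. u ^ k * (\<Sum>i=1..<k. X i (k - i))) = sum ?Y ?low"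
  proof -
    have "(\<Sum>k=1..p. u ^ k * (\<Sum>i=1..<k. X i (k - i)))
        = (\<Sum>(k, i)\<in>Sigma {1..p} (\<lambda>k. {1..<k}). u ^ k * X i (k - i))"
      by (simp add: sum_distrib_left sum.Sigma)
    also have "\<dots> = sum ?Y ?low"
      by (rule sum.reindex_bij_witness[of _ "\<lambda>(j, i). (i + j, i)" "\<lambda>(k, i). (k - i, i)"]) auto
    finally show ?thesis .
  qed
  have "\<bar>sum ?Y ?high\<bar> \<le> of_nat (card ?high) * (u ^ (p + 1) * K)"
    unfolding real_norm_def[symmetric]
  proof (rule sum_norm_bound)
    fix x assume x: "x \<in> ?high"
    then have "u ^ (fst x + snd x) \<le> u ^ (p + 1)" using u by (intro power_decreasing) auto
    then show "norm (?Y x) \<le> u ^ (p + 1) * K"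
      using X[of "snd x" "fst x"] x u by (auto simp: abs_mult intro!: mult_mono)
  qed
  also have "\<dots> \<le> real (p * p) * (u ^ (p + 1) * K)"
  proof (rule mult_right_mono)
    have "card ?high \<le> card ?P" by (intro card_mono) auto
    then show "real (card ?high) \<le> real (p * p)" by (simp flip: of_nat_mult)
    have "0 \<le> K" using X[of 1 1] p by force
    then show "0 \<le> u ^ (p + 1) * K" using u by simp
  qed
  finally show ?thesis using 1 2 3 by simp
qed

text \<open>The algebra behind averaging, at a fixed point of phase space. \<open>F\<close>, \<open>G\<close> and \<open>Sd\<close> stand for \<open>f\<close>, \<open>g\<close>
  and \<open>dS/dt\<close>, and \<open>\<tau>\<close> for \<open>1 / t\<close>. The homological equations cancel all contributions up to order
  \<open>p\<close> except \<open>u\<^sup>p \<Lambda>\<close>. Three kinds of error remain: the truncation errors \<open>ef\<close>, \<open>eg\<close>, \<open>es\<close>, the products of total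
  degree above \<open>p\<close>, and the time derivatives of the powers of \<open>u\<close>.\<close>

lemma near_identity_drift_estimate:
  fixes u e B m r :: real and fi gi \<sigma> v vr v\<phi> vS :: "nat \<Rightarrow> real"
  defines "X \<equiv> \<lambda>i j. fi i * vr j + gi i * v\<phi> j / r + \<sigma> i * vS j"
  assumes F: "F = (\<Sum>i=1..p. u ^ i * fi i) + u ^ p * ef"
    and G: "G = (\<Sum>i=1..p. u ^ i * gi i) + u ^ p * eg"
    and Sd: "Sd = s0 + (\<Sum>i=1..p. u ^ i * \<sigma> i) + u ^ p * es"
    and hom: "\<And>k. k \<in> {1..p} \<Longrightarrow> w * v\<phi> k + s0 * vS k
                = (if k = p then \<Lambda> else 0) - fi k - (\<Sum>i=1..<k. X i (k - i))"
    and B: "\<And>k. k \<in> {1..p} \<Longrightarrow> \<bar>fi k\<bar> \<le> B" "\<And>k. k \<in> {1..p} \<Longrightarrow> \<bar>gi k\<bar> \<le> B"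
      "\<And>k. k \<in> {1..p} \<Longrightarrow> \<bar>\<sigma> k\<bar> \<le> B" "\<And>k. k \<in> {1..p} \<Longrightarrow> \<bar>v k\<bar> \<le> B"
      "\<And>k. k \<in> {1..p} \<Longrightarrow> \<bar>vr k\<bar> \<le> B" "\<And>k. k \<in> {1..p} \<Longrightarrow> \<bar>v\<phi> k\<bar> \<le> B"
      "\<And>k. k \<in> {1..p} \<Longrightarrow> \<bar>vS k\<bar> \<le> B"
    and e: "\<bar>ef\<bar> \<le> e" "\<bar>eg\<bar> \<le> e" "\<bar>es\<bar> \<le> e"
    and m: "0 < m" "m \<le> \<bar>r\<bar>" and u: "0 \<le> u" "u \<le> 1" "u \<le> e" and \<tau>: "0 \<le> \<tau>" "\<tau> \<le> u ^ p"
    and p: "1 \<le> p" "p \<le> q"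
  shows "\<bar>F + (\<Sum>k=1..p. u ^ k * (F * vr k + (w + G / r) * v\<phi> k + Sd * vS k)
                        - real k / real q * u ^ k * \<tau> * v k) - u ^ p * \<Lambda>\<bar>
     \<le> e * u ^ p * (1 + p * (B + B / m + B + B) + real (p * p) * (B * B + B * B / m + B * B))"
proof -
  have B0: "B \<ge> 0" using B(1)[of 1] p by force
  have e0: "e \<ge> 0" using e by linarith
  have up: "u ^ p \<ge> 0" using u by simp
  have r: "r \<noteq> 0" using m by auto
  define K where "K = B * B + B * B / m + B * B"
  define E where "E k = u ^ k * (u ^ p * (ef * vr k + eg / r * v\<phi> k + es * vS k))
       - real k / real q * u ^ k * \<tau> * v k" for k
  define Q where "Q = (\<Sum>j=1..p. u ^ j * (\<Sum>i=1..p. u ^ i * X i j))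
       - (\<Sum>k=1..p. u ^ k * (\<Sum>i=1..<k. X i (k - i)))"
  have split: "u ^ k * (F * vr k + (w + G / r) * v\<phi> k + Sd * vS k)
           - real k / real q * u ^ k * \<tau> * v k
      = u ^ k * (w * v\<phi> k + s0 * vS k) + u ^ k * (\<Sum>i=1..p. u ^ i * X i k) + E k" for k
  proof -
    have "(\<Sum>i=1..p. u ^ i * X i k) = (\<Sum>i=1..p. u ^ i * fi i) * vr k
        + (\<Sum>i=1..p. u ^ i * gi i) / r * v\<phi> k + (\<Sum>i=1..p. u ^ i * \<sigma> i) * vS k"
      by (simp only: X_def distrib_left sum.distrib sum_distrib_right sum_divide_distrib) (simp add: mult_ac)
    then show ?thesis unfolding F G Sd E_def by (simp add: algebra_simps add_divide_distrib)
  qed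
  have "(\<Sum>k=1..p. u ^ k * (w * v\<phi> k + s0 * vS k))
      = (\<Sum>k=1..p. (if k = p then u ^ p * \<Lambda> else 0) - u ^ k * fi k - u ^ k * (\<Sum>i=1..<k. X i (k - i)))"
  proof (intro sum.cong refl)
    fix k assume k: "k \<in> {1..p}"
    show "u ^ k * (w * v\<phi> k + s0 * vS k)
      = (if k = p then u ^ p * \<Lambda> else 0) - u ^ k * fi k - u ^ k * (\<Sum>i=1..<k. X i (k - i))"
      unfolding hom[OF k] by (simp add: right_diff_distrib)
  qed
  also have "\<dots> = u ^ p * \<Lambda> - (\<Sum>k=1..p. u ^ k * fi k) - (\<Sum>k=1..p. u ^ k * (\<Sum>i=1..<k. X i (k - i)))"
    using p by (simp add: sum_subtractf sum.delta)
  finally have main: "F + (\<Sum>k=1..p. u ^ k * (F * vr k + (w + G / r) * v\<phi> k + Sd * vS k)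
                        - real k / real q * u ^ k * \<tau> * v k) - u ^ p * \<Lambda>
      = u ^ p * ef + Q + (\<Sum>k=1..p. E k)"
    unfolding split sum.distrib Q_def using F by simp
  have "\<bar>u ^ p * ef\<bar> \<le> e * u ^ p" using e up by (simp add: abs_mult mult.commute mult_right_mono)
  moreover have "\<bar>Q\<bar> \<le> e * u ^ p * (real (p * p) * K)"
  proof -
    have "\<bar>X i j\<bar> \<le> K" if "i \<in> {1..p}" "j \<in> {1..p}" for i j
    proof -
      have "\<bar>fi i * vr j\<bar> \<le> B * B" "\<bar>\<sigma> i * vS j\<bar> \<le> B * B" "\<bar>gi i * v\<phi> j / r\<bar> \<le> B * B / m"
        unfolding abs_mult abs_divide using B that B0 m
        by (auto intro!: mult_mono frac_le)
      then show ?thesis unfolding X_def K_def by linarith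
    qed
    then have "\<bar>Q\<bar> \<le> real (p * p) * (u ^ (p + 1) * K)"
      unfolding Q_def by (intro sum_pairs_regrouped_bound u p)
    also have "\<dots> \<le> real (p * p) * ((e * u ^ p) * K)"
    proof -
      have "u ^ (p + 1) \<le> e * u ^ p" using u up by (simp add: mult_right_mono)
      moreover have "K \<ge> 0" using B0 m by (simp add: K_def)
      ultimately show ?thesis by (intro mult_left_mono mult_right_mono) auto
    qed
    finally show ?thesis by (simp add: mult_ac)
  qed
  moreover have "\<bar>\<Sum>k=1..p. E k\<bar> \<le> e * u ^ p * (p * (B + B / m + B + B))"
  proof -
    have "\<bar>E k\<bar> \<le> e * u ^ p * (B + B / m + B + B)" if k: "k \<in> {1..p}" for k
    proof -
      have uk: "0 \<le> u ^ k" "u ^ k \<le> 1" using u by (auto simp: power_le_one)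
      have "u ^ k \<le> u ^ 1" using u k by (intro power_decreasing) auto
      then have uk_e: "u ^ k \<le> e" using u by simp
      have "\<bar>ef * vr k\<bar> \<le> e * B" "\<bar>es * vS k\<bar> \<le> e * B"
        unfolding abs_mult using B k e e0 by (auto intro!: mult_mono)
      moreover have "\<bar>eg / r * v\<phi> k\<bar> \<le> (e / m) * B"
        unfolding abs_mult abs_divide using B k e e0 m by (intro mult_mono frac_le) auto
      moreover have "e * (B + B / m + B) = e * B + (e / m) * B + e * B"
        by (simp add: algebra_simps)
      ultimately have "\<bar>ef * vr k + eg / r * v\<phi> k + es * vS k\<bar> \<le> e * (B + B / m + B)"
        by linarith
      then have "\<bar>u ^ k * (u ^ p * (ef * vr k + eg / r * v\<phi> k + es * vS k))\<bar>
          \<le> 1 * (u ^ p * (e * (B + B / m + B)))"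
        unfolding abs_mult[of "u ^ k"] abs_mult[of "u ^ p"] using uk up by (intro mult_mono) auto
      moreover have "\<bar>real k / real q * u ^ k * \<tau> * v k\<bar> \<le> 1 * e * u ^ p * B"
        unfolding abs_mult using uk uk_e \<tau> B k p e0 up by (intro mult_mono) auto
      moreover have "e * u ^ p * (B + B / m + B + B) = 1 * (u ^ p * (e * (B + B / m + B))) + 1 * e * u ^ p * B"
        by (simp add: algebra_simps)
      ultimately show ?thesis unfolding E_def by linarith
    qed
    then have "norm (\<Sum>k=1..p. E k) \<le> of_nat (card {1..p}) * (e * u ^ p * (B + B / m + B + B))"
      by (intro sum_norm_bound) auto
    then show ?thesis by (simp add: mult_ac)
  qed
  ultimately show ?thesis
    unfolding main K_def[symmetric] distrib_left[of "e * u ^ p"] by linarith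
qed

lemma taylor_coeff_eq_0:
  assumes a: "a > 0" and h: "\<And>r. \<bar>r\<bar> \<le> a \<Longrightarrow> h r = 0" and r: "\<bar>r\<bar> \<le> a"
  shows "taylor_coeff a h r m = 0"
proof -
  have "\<forall>r. \<bar>r\<bar> \<le> a \<longrightarrow> (deriv_within a ^^ m) h r = 0"
  proof (induction m)
    case 0
    then show ?case using h by simp
  next
    case (Suc m)
    show ?case
    proof (intro allI impI)
      fix r assume r: "\<bar>r\<bar> \<le> a"
      have "((\<lambda>_. 0) has_vector_derivative 0) (at r within {-a..a})" by simp
      then have "((deriv_within a ^^ m) h has_vector_derivative 0) (at r within {-a..a})"
        by (rule has_vector_derivative_transform[rotated 2]) (use Suc r in \<open>auto simp: abs_le_iff\<close>)
      then show "(deriv_within a ^^ Suc m) h r = 0"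
        using vector_derivative_within_cbox[of "-a" a r] a r
        by (auto simp: deriv_within_def abs_le_iff)
    qed
  qed
  then show ?thesis using r by (simp add: taylor_coeff_def)
qed

text \<open>As long as all previous \<open>\<Lambda>\<^sub>j\<close> vanish, the Taylor part of the remainder disappears; the summand
  \<open>(1 - k / q) v\<^sub>k\<^sub>-\<^sub>q\<close> disappears because \<open>k \<le> q\<close> and \<open>v\<^sub>0 = 0\<close>.\<close>

lemma averaging_remainder_leading:
  assumes a: "a > 0" and r: "\<bar>r\<bar> \<le> a" "r \<noteq> 0" and k: "1 \<le> k" "k \<le> q"
    and \<Lambda>: "\<And>j r. 1 \<le> j \<Longrightarrow> j < k \<Longrightarrow> \<bar>r\<bar> \<le> a \<Longrightarrow> \<Lambda> j r = 0"
    and v0: "\<And>r \<phi> S. v 0 r \<phi> S = 0"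
  shows "averaging_remainder a q \<sigma> fc gc \<Lambda> v k r \<phi> S =
    - (\<Sum>i=1..<k. fc i r \<phi> S * deriv_within a (\<lambda>x. v (k - i) x \<phi> S) r
          + gc i r \<phi> S * deriv (\<lambda>y. v (k - i) r y S) \<phi> / r
          + \<sigma> i * deriv (\<lambda>y. v (k - i) r \<phi> y) S)"
proof -
  have "(\<Sum>j=1..<k. fps_X ^ j *
        (fps_compose (Abs_fps (taylor_coeff a (\<Lambda> j) r)) (Abs_fps (\<lambda>i. if i = 0 then 0 else v i r \<phi> S))
         - fps_const (\<Lambda> j r))) = 0"
  proof (rule sum.neutral, rule ballI)
    fix j assume j: "j \<in> {1..<k}"
    then have "taylor_coeff a (\<Lambda> j) r = (\<lambda>_. 0)" "\<Lambda> j r = 0"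
      using taylor_coeff_eq_0[OF a _ r(1), of "\<Lambda> j"] \<Lambda> r(1) by auto
    then show "fps_X ^ j *
        (fps_compose (Abs_fps (taylor_coeff a (\<Lambda> j) r)) (Abs_fps (\<lambda>i. if i = 0 then 0 else v i r \<phi> S))
         - fps_const (\<Lambda> j r)) = 0"
      by (simp flip: fps_zero_def)
  qed
  then show ?thesis
    unfolding averaging_remainder_def using k r(2) by (simp add: v0 radial_quotient_def)
qed

lemma phase_has_real_derivative:
  assumes t: "t > 0" and q: "q \<ge> 1"
  shows "(phase q s has_real_derivative (\<Sum>i\<le>q. phase_deriv_coeff q s i * t powr (- (real i / real q)))) (at t)"
proof -
  have "(\<Sum>i\<le>q. phase_deriv_coeff q s i * t powr (- (real i / real q))) =
     s 0 + (\<Sum>k=1..<q. s k * ((1 - real k / real q) * t powr (- (real k / real q)))) + s q * (1 / t)"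
  proof -
    have "{..q} = insert 0 (insert q {1..<q})" using q by auto
    moreover have "t powr - 1 = 1 / t" using t by (simp add: powr_minus_divide)
    ultimately show ?thesis
      using q t by (simp add: phase_deriv_coeff_def mult_ac)
  qed
  moreover have "(phase q s has_real_derivative s 0 +
      (\<Sum>k=1..<q. s k * ((1 - real k / real q) * t powr (- (real k / real q)))) + s q * (1 / t)) (at t)"
    unfolding phase_def
    using t by (auto intro!: derivative_eq_intros sum.cong simp: field_simps)
  ultimately show ?thesis by simp
qed

text \<open>The time derivative of \<^const>\<open>transformed_radius\<close> at a point where the radius and the angle move
  with velocities \<open>R\<close> and \<open>P\<close>.\<close>

definition transformed_radius_rate ::
  "real \<Rightarrow> nat \<Rightarrow> nat \<Rightarrow> (nat \<Rightarrow> real) \<Rightarrow> (nat \<Rightarrow> real \<Rightarrow> real \<Rightarrow> real \<Rightarrow> real) \<Rightarrow>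
   real \<Rightarrow> real \<Rightarrow> real \<Rightarrow> real \<Rightarrow> real \<Rightarrow> real" where
  "transformed_radius_rate a q p s v r \<phi> t R P =
     (let S = phase q s t;
          S' = (\<Sum>i\<le>q. phase_deriv_coeff q s i * t powr (- (real i / real q)))
      in R + (\<Sum>k=1..p. t powr (- (real k / real q)) *
              (R * deriv_within a (\<lambda>x. v k x \<phi> S) r + P * deriv (\<lambda>y. v k r y S) \<phi>
               + S' * deriv (\<lambda>y. v k r \<phi> y) S)
            - real k / real q * t powr (- (real k / real q)) * (1 / t) * v k r \<phi> S))"

lemma transformed_radius_has_derivative:
  assumes a: "a > 0" and q: "q \<ge> 1" and t: "t > 0"
    and sm: "\<And>k. k \<in> {1..p} \<Longrightarrow> smooth_strip a (v k)"
    and per: "\<And>k r. k \<in> {1..p} \<Longrightarrow> \<bar>r\<bar> \<le> a \<Longrightarrow> periodic2 (v k r)"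
    and r: "\<bar>r t\<bar> < a"
    and dr: "(r has_real_derivative R) (at t within I)" and d\<phi>: "(\<phi> has_real_derivative P) (at t within I)"
  shows "((\<lambda>t. transformed_radius q p (phase q s) v (r t) (\<phi> t) t) has_real_derivative
      transformed_radius_rate a q p s v (r t) (\<phi> t) t R P) (at t within I)"
proof -
  define S' where "S' = (\<Sum>i\<le>q. phase_deriv_coeff q s i * t powr (- (real i / real q)))"
  have dS: "(phase q s has_real_derivative S') (at t within I)"
    unfolding S'_def using phase_has_real_derivative[OF t q] has_field_derivative_at_within by blast
  define vt where "vt k = R * deriv_within a (\<lambda>x. v k x (\<phi> t) (phase q s t)) (r t)
      + P * deriv (\<lambda>y. v k (r t) y (phase q s t)) (\<phi> t)
      + S' * deriv (\<lambda>y. v k (r t) (\<phi> t) y) (phase q s t)" for k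
  have dv: "((\<lambda>t. v k (r t) (\<phi> t) (phase q s t)) has_real_derivative vt k) (at t within I)"
    if k: "k \<in> {1..p}" for k
  proof -
    let ?A = "{(r::real, \<phi>::real, S::real). \<bar>r\<bar> \<le> a}"
    have "open ({-a<..<a} \<times> (UNIV :: real set) \<times> (UNIV :: real set))"
      by (intro open_Times open_UNIV) auto
    moreover have "(r t, \<phi> t, phase q s t) \<in> {-a<..<a} \<times> UNIV \<times> UNIV" using r by auto
    ultimately have "(r t, \<phi> t, phase q s t) \<in> interior ?A"
      by (rule interiorI) auto
    from at_within_interior[OF this]
    have "((\<lambda>(r, \<phi>, S). v k r \<phi> S) has_derivative
        (\<lambda>(x, y, z). x * deriv_within a (\<lambda>x. v k x (\<phi> t) (phase q s t)) (r t)
          + y * deriv (\<lambda>y. v k (r t) y (phase q s t)) (\<phi> t)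
          + z * deriv (\<lambda>y. v k (r t) (\<phi> t) y) (phase q s t))) (at (r t, \<phi> t, phase q s t))"
      using smooth_periodic_strip_partials(1)[OF a sm[OF k] per[OF k], of "r t" "\<phi> t" "phase q s t"] r
      by simp
    moreover have "((\<lambda>t. (r t, \<phi> t, phase q s t)) has_derivative (\<lambda>h. (R * h, P * h, S' * h))) (at t within I)"
      using dr d\<phi> dS by (intro has_derivative_Pair) (simp_all add: has_field_derivative_def)
    ultimately have "((\<lambda>t. (\<lambda>(r, \<phi>, S). v k r \<phi> S) (r t, \<phi> t, phase q s t)) has_derivative
        (\<lambda>h. (\<lambda>(x, y, z). x * deriv_within a (\<lambda>x. v k x (\<phi> t) (phase q s t)) (r t)
          + y * deriv (\<lambda>y. v k (r t) y (phase q s t)) (\<phi> t)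
          + z * deriv (\<lambda>y. v k (r t) (\<phi> t) y) (phase q s t)) (R * h, P * h, S' * h))) (at t within I)"
      by (rule has_derivative_compose[rotated])
    moreover have "(\<lambda>h. (\<lambda>(x, y, z). x * deriv_within a (\<lambda>x. v k x (\<phi> t) (phase q s t)) (r t)
          + y * deriv (\<lambda>y. v k (r t) y (phase q s t)) (\<phi> t)
          + z * deriv (\<lambda>y. v k (r t) (\<phi> t) y) (phase q s t)) (R * h, P * h, S' * h)) = (*) (vt k)"
      by (simp add: fun_eq_iff vt_def algebra_simps)
    ultimately show ?thesis
      by (simp add: has_field_derivative_def)
  qed
  have du: "((\<lambda>t. t powr (- (real k / real q))) has_real_derivative
      - (real k / real q * t powr (- (real k / real q)) * (1 / t))) (at t within I)" for k
  proof -
    have "((\<lambda>t. t powr (- (real k / real q))) has_real_derivative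
        - (real k / real q * t powr (- (real k / real q)) * (1 / t))) (at t)"
      using t by (auto intro!: derivative_eq_intros simp: powr_diff)
    then show ?thesis by (rule has_field_derivative_at_within)
  qed
  have "((\<lambda>t. r t + (\<Sum>k=1..p. t powr (- (real k / real q)) * v k (r t) (\<phi> t) (phase q s t)))
     has_real_derivative R + (\<Sum>k=1..p. t powr (- (real k / real q)) * vt k +
        - (real k / real q * t powr (- (real k / real q)) * (1 / t)) * v k (r t) (\<phi> t) (phase q s t)))
     (at t within I)"
    by (intro DERIV_add dr DERIV_sum DERIV_mult' du dv)
  then show ?thesis
    unfolding transformed_radius_def transformed_radius_rate_def Let_def vt_def S'_def by simp
qed

lemma finite_family_bound:
  fixes P :: "'k \<Rightarrow> real \<Rightarrow> bool"
  assumes "finite K" and ex: "\<And>k. k \<in> K \<Longrightarrow> \<exists>B. P k B"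
    and mono: "\<And>k B B'. k \<in> K \<Longrightarrow> P k B \<Longrightarrow> B \<le> B' \<Longrightarrow> P k B'"
  shows "\<exists>B. \<forall>k\<in>K. P k B"
proof -
  have "eventually (\<lambda>B. \<forall>k\<in>K. P k B) at_top"
    unfolding eventually_ball_finite_distrib[OF \<open>finite K\<close>] eventually_at_top_linorder
    using ex mono by blast
  then show ?thesis by (auto simp: eventually_at_top_linorder)
qed

lemma periodic_family_derivative_bounds:
  fixes v :: "nat \<Rightarrow> real \<Rightarrow> real \<Rightarrow> real \<Rightarrow> real"
  assumes a: "a > 0"
    and sm: "\<And>k. k \<in> {1..p} \<Longrightarrow> smooth_strip a (v k)"
    and per: "\<And>k r. k \<in> {1..p} \<Longrightarrow> \<bar>r\<bar> \<le> a \<Longrightarrow> periodic2 (v k r)"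
  shows "\<exists>B::real. \<forall>k\<in>{1..p}. \<forall>r \<phi> S. \<bar>r\<bar> \<le> a \<longrightarrow> \<bar>v k r \<phi> S\<bar> \<le> B \<and>
      \<bar>deriv_within a (\<lambda>x. v k x \<phi> S) r\<bar> \<le> B \<and>
      \<bar>deriv (\<lambda>y. v k r y S) \<phi>\<bar> \<le> B \<and> \<bar>deriv (\<lambda>y. v k r \<phi> y) S\<bar> \<le> B"
proof -
  let ?P = "\<lambda>k B. \<forall>r \<phi> S. \<bar>r\<bar> \<le> a \<longrightarrow> \<bar>v k r \<phi> S\<bar> \<le> B \<and> \<bar>deriv_within a (\<lambda>x. v k x \<phi> S) r\<bar> \<le> B \<and>
        \<bar>deriv (\<lambda>y. v k r y S) \<phi>\<bar> \<le> B \<and> \<bar>deriv (\<lambda>y. v k r \<phi> y) S\<bar> \<le> B"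
  show ?thesis
  proof (rule finite_family_bound[of "{1..p}" ?P])
    show "\<exists>B. ?P k B" if "k \<in> {1..p}" for k
      by (rule smooth_periodic_strip_partials(2)[OF a sm[OF that] per[OF that]])
    show "?P k B'" if "?P k B" "B \<le> B'" for k B B'
      using that(1) order_trans[OF _ that(2)] by blast
  qed simp
qed

lemma powr_neg_quotient: "t > 0 \<Longrightarrow> t powr (- (real k / real q)) = (t powr (- (1 / real q))) ^ k"
  by (simp add: powr_power)

lemma tendsto_powr_neg_inverse: "q \<ge> 1 \<Longrightarrow> ((\<lambda>t. t powr (- (1 / real q))) \<longlongrightarrow> 0) at_top"
  by (rule tendsto_neg_powr) (auto intro: filterlim_ident)

lemma transformed_radius_near_identity:
  assumes a: "a > 0" and q: "q \<ge> 1"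
    and sm: "\<And>k. k \<in> {1..p} \<Longrightarrow> smooth_strip a (v k)"
    and per: "\<And>k r. k \<in> {1..p} \<Longrightarrow> \<bar>r\<bar> \<le> a \<Longrightarrow> periodic2 (v k r)"
    and \<eta>: "\<eta> > 0"
  shows "eventually (\<lambda>t. \<forall>r \<phi>. \<bar>r\<bar> \<le> a \<longrightarrow> \<bar>transformed_radius q p S v r \<phi> t - r\<bar> \<le> \<eta>) at_top"
proof -
  obtain B0 where B0: "\<And>k r \<phi> S. k \<in> {1..p} \<Longrightarrow> \<bar>r\<bar> \<le> a \<Longrightarrow> \<bar>v k r \<phi> S\<bar> \<le> B0"
    using periodic_family_derivative_bounds[where a = a and p = p and v = v, OF a sm per] by blast
  define B where "B = max B0 1"
  have B: "B \<ge> 1" "\<And>k r \<phi> S. k \<in> {1..p} \<Longrightarrow> \<bar>r\<bar> \<le> a \<Longrightarrow> \<bar>v k r \<phi> S\<bar> \<le> B"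
    using B0 by (auto simp: B_def le_max_iff_disj)
  define e where "e = min 1 (\<eta> / (real (Suc p) * B))"
  have e: "e > 0" using \<eta> B by (simp add: e_def)
  have "eventually (\<lambda>t. t powr (- (1 / real q)) < e) at_top"
    by (rule order_tendstoD(2)[OF tendsto_powr_neg_inverse[OF q] e])
  then show ?thesis using eventually_gt_at_top[of 0]
  proof eventually_elim
    case (elim t)
    define u where "u = t powr (- (1 / real q))"
    have u: "0 \<le> u" "u \<le> 1" "u \<le> \<eta> / (real (Suc p) * B)" using elim by (auto simp: u_def e_def)
    show ?case
    proof (intro allI impI)
      fix r \<phi> assume r: "\<bar>r\<bar> \<le> a"
      have "norm (\<Sum>k=1..p. u ^ k * v k r \<phi> (S t)) \<le> of_nat (card {1..p}) * (u * B)"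
      proof (rule sum_norm_bound)
        fix k assume k: "k \<in> {1..p}"
        have "u ^ k \<le> u ^ 1" using u k by (intro power_decreasing) auto
        then show "norm (u ^ k * v k r \<phi> (S t)) \<le> u * B"
          using B k r u by (auto simp: abs_mult intro!: mult_mono)
      qed
      also have "\<dots> \<le> u * (real (Suc p) * B)" using u B by (simp add: algebra_simps)
      also have "\<dots> \<le> \<eta>" using u(3) B by (simp add: pos_le_divide_eq)
      finally show "\<bar>transformed_radius q p S v r \<phi> t - r\<bar> \<le> \<eta>"
        using elim by (simp add: transformed_radius_def powr_neg_quotient u_def)
    qed
  qed
qed

text \<open>Writing the remainder as \<open>u\<^sup>K x\<close> with small \<open>x\<close> turns the asymptotic series into an exact polynomial
  identity in \<open>u\<close>, to which the algebraic estimate applies.\<close>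

lemma asymptotic_series_truncation:
  assumes ser: "has_asymptotic_series a q h hc" and e: "e > 0"
  shows "eventually (\<lambda>t. \<forall>r \<phi> S. \<bar>r\<bar> \<le> a \<longrightarrow>
     (\<exists>x. \<bar>x\<bar> \<le> e \<and> h r \<phi> S t = (\<Sum>k=1..K. (t powr (- (1 / real q))) ^ k * hc k r \<phi> S)
            + (t powr (- (1 / real q))) ^ K * x)) at_top"
proof -
  have "eventually (\<lambda>t. \<forall>r \<phi> S. \<bar>r\<bar> \<le> a \<longrightarrow>
        \<bar>h r \<phi> S t - (\<Sum>k=1..K. t powr (- (real k / real q)) * hc k r \<phi> S)\<bar>
          \<le> e * t powr (- (real K / real q))) at_top"
    using ser e unfolding has_asymptotic_series_def by blast
  then show ?thesis using eventually_gt_at_top[of 0]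
  proof eventually_elim
    case (elim t)
    define u where "u = t powr (- (1 / real q))"
    have u: "u ^ K > 0" using elim by (simp add: u_def)
    show ?case
    proof (intro allI impI)
      fix r \<phi> S assume r: "\<bar>r\<bar> \<le> a"
      define y where "y = h r \<phi> S t - (\<Sum>k=1..K. u ^ k * hc k r \<phi> S)"
      have "\<bar>y\<bar> \<le> e * u ^ K"
        using elim(1)[rule_format, OF r, of \<phi> S] elim(2) by (simp add: y_def u_def powr_neg_quotient)
      then have "\<bar>y / u ^ K\<bar> \<le> e" using u by (simp add: abs_divide pos_divide_le_eq)
      moreover have "h r \<phi> S t = (\<Sum>k=1..K. u ^ k * hc k r \<phi> S) + u ^ K * (y / u ^ K)"
      proof -
        have "u ^ K \<noteq> 0" using u by (rule less_imp_neq[symmetric])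
        then have "u ^ K * (y / u ^ K) = y" by (metis nonzero_mult_div_cancel_left times_divide_eq_right)
        then show ?thesis by (simp add: y_def)
      qed
      ultimately show "\<exists>x. \<bar>x\<bar> \<le> e \<and> h r \<phi> S t = (\<Sum>k=1..K. (t powr (- (1 / real q))) ^ k * hc k r \<phi> S)
            + (t powr (- (1 / real q))) ^ K * x"
        unfolding u_def by blast
    qed
  qed
qed

text \<open>The averaging step. All error terms in \<open>near_identity_drift_estimate\<close> carry a factor that tends
  to \<open>0\<close> as \<open>t\<close> grows, and the remaining factors are bounded by periodicity.\<close>

lemma averaged_radius_rate:
  fixes f g :: "real \<Rightarrow> real \<Rightarrow> real \<Rightarrow> real \<Rightarrow> real"
  assumes a: "0 < a" "a \<le> r0" and q: "q \<ge> 1" and p: "1 \<le> p" "p \<le> q" "p \<le> N"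
    and series_f: "has_asymptotic_series r0 q f fc"
    and series_g: "has_asymptotic_series r0 q g gc"
    and smooth_fc: "\<And>k. k \<ge> 1 \<Longrightarrow> smooth_strip r0 (fc k)"
    and smooth_gc: "\<And>k. k \<ge> 1 \<Longrightarrow> smooth_strip r0 (gc k)"
    and periodic_fc: "\<And>k r. k \<ge> 1 \<Longrightarrow> \<bar>r\<bar> \<le> r0 \<Longrightarrow> periodic2 (fc k r)"
    and periodic_gc: "\<And>k r. k \<ge> 1 \<Longrightarrow> \<bar>r\<bar> \<le> r0 \<Longrightarrow> periodic2 (gc k r)"
    and averaging: "averaging_sequence a q N \<omega> s fc gc \<Lambda> v"
    and \<Lambda>0: "\<And>k r. 1 \<le> k \<Longrightarrow> k < p \<Longrightarrow> \<bar>r\<bar> \<le> a \<Longrightarrow> \<Lambda> k r = 0"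
    and m: "m > 0" and \<eta>: "\<eta> > 0"
  shows "eventually (\<lambda>t. \<forall>r \<phi>. m \<le> \<bar>r\<bar> \<and> \<bar>r\<bar> \<le> a \<longrightarrow>
     \<bar>transformed_radius_rate a q p s v r \<phi> t (f r \<phi> (phase q s t) t)
        (\<omega> r + g r \<phi> (phase q s t) t / r) - t powr (- (real p / real q)) * \<Lambda> p r\<bar>
      \<le> \<eta> * t powr (- (real p / real q))) at_top"
proof -
  define \<sigma> where "\<sigma> = phase_deriv_coeff q s"
  have v0: "v 0 r \<phi> S = 0" for r \<phi> S
    using averaging unfolding averaging_sequence_def Let_def by simp
  have smv: "smooth_strip a (v k)" and perv: "\<bar>r\<bar> \<le> a \<Longrightarrow> periodic2 (v k r)"
    and hom: "\<bar>r\<bar> \<le> a \<Longrightarrow> \<omega> r * deriv (\<lambda>y. v k r y S) \<phi> + s 0 * deriv (\<lambda>y. v k r \<phi> y) S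
         = homological_rhs a q \<sigma> fc gc \<Lambda> v k r \<phi> S" if "k \<in> {1..p}" for k r \<phi> S
    using averaging p that unfolding averaging_sequence_def Let_def \<sigma>_def by auto
  obtain Bv where Bv: "\<And>k r \<phi> S. k \<in> {1..p} \<Longrightarrow> \<bar>r\<bar> \<le> a \<Longrightarrow> \<bar>v k r \<phi> S\<bar> \<le> Bv \<and>
      \<bar>deriv_within a (\<lambda>x. v k x \<phi> S) r\<bar> \<le> Bv \<and>
      \<bar>deriv (\<lambda>y. v k r y S) \<phi>\<bar> \<le> Bv \<and> \<bar>deriv (\<lambda>y. v k r \<phi> y) S\<bar> \<le> Bv"
    using periodic_family_derivative_bounds[where a = a and p = p and v = v, OF a(1) smv perv] by blast
  have r0: "r0 > 0" using a by simp
  obtain Bf where Bf: "\<And>k r \<phi> S. k \<in> {1..p} \<Longrightarrow> \<bar>r\<bar> \<le> r0 \<Longrightarrow> \<bar>fc k r \<phi> S\<bar> \<le> Bf"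
  proof -
    have "\<exists>B. \<forall>k\<in>{1..p}. \<forall>r \<phi> S. \<bar>r\<bar> \<le> r0 \<longrightarrow> \<bar>fc k r \<phi> S\<bar> \<le> B \<and>
      \<bar>deriv_within r0 (\<lambda>x. fc k x \<phi> S) r\<bar> \<le> B \<and>
      \<bar>deriv (\<lambda>y. fc k r y S) \<phi>\<bar> \<le> B \<and> \<bar>deriv (\<lambda>y. fc k r \<phi> y) S\<bar> \<le> B"
      by (rule periodic_family_derivative_bounds[OF r0]) (simp_all add: smooth_fc periodic_fc)
    then show thesis using that by blast
  qed
  obtain Bg where Bg: "\<And>k r \<phi> S. k \<in> {1..p} \<Longrightarrow> \<bar>r\<bar> \<le> r0 \<Longrightarrow> \<bar>gc k r \<phi> S\<bar> \<le> Bg"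
  proof -
    have "\<exists>B. \<forall>k\<in>{1..p}. \<forall>r \<phi> S. \<bar>r\<bar> \<le> r0 \<longrightarrow> \<bar>gc k r \<phi> S\<bar> \<le> B \<and>
      \<bar>deriv_within r0 (\<lambda>x. gc k x \<phi> S) r\<bar> \<le> B \<and>
      \<bar>deriv (\<lambda>y. gc k r y S) \<phi>\<bar> \<le> B \<and> \<bar>deriv (\<lambda>y. gc k r \<phi> y) S\<bar> \<le> B"
      by (rule periodic_family_derivative_bounds[OF r0]) (simp_all add: smooth_gc periodic_gc)
    then show thesis using that by blast
  qed
  define Bs where "Bs = (\<Sum>i\<le>q. \<bar>\<sigma> i\<bar>)"
  have Bs: "\<bar>\<sigma> i\<bar> \<le> Bs" if "i \<le> q" for i
    unfolding Bs_def by (rule member_le_sum) (use that in auto)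
  have Bs0: "Bs \<ge> 0" by (simp add: Bs_def sum_nonneg)
  define B where "B = \<bar>Bv\<bar> + \<bar>Bf\<bar> + \<bar>Bg\<bar> + Bs"
  define C where "C = 1 + p * (B + B / m + B + B) + real (p * p) * (B * B + B * B / m + B * B)"
  have B0: "B \<ge> 0" using Bs0 by (simp add: B_def)
  then have C: "C > 0" using m by (simp add: C_def add_pos_nonneg)
  \<comment> \<open>\<open>C\<close> is the constant of the algebraic estimate, so errors below \<open>e\<close> give total error \<open>\<eta>\<close>.\<close>
  define e where "e = \<eta> / C"
  have e: "e > 0" using \<eta> C by (simp add: e_def)
  define e' where "e' = min 1 (e / (Bs + 1))"
  have e': "e' > 0" using e Bs0 by (simp add: e'_def)
  have "eventually (\<lambda>t. t powr (- (1 / real q)) < e') at_top"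
    by (rule order_tendstoD(2)[OF tendsto_powr_neg_inverse[OF q] e'])
  then show ?thesis
    using asymptotic_series_truncation[OF series_f e, of p] asymptotic_series_truncation[OF series_g e, of p]
      eventually_gt_at_top[of 0]
  proof eventually_elim
    case (elim t)
    define u where "u = t powr (- (1 / real q))"
    define S where "S = phase q s t"
    have u0: "u > 0" and u1: "u \<le> 1" and u_le: "u \<le> e / (Bs + 1)"
      using elim by (auto simp: u_def e'_def)
    have u_Bs: "u * Bs + u \<le> e" using u_le Bs0 by (simp add: pos_le_divide_eq distrib_left)
    then have ue: "u \<le> e" using u0 Bs0 mult_nonneg_nonneg[of u Bs] by linarith
    \<comment> \<open>This is where \<open>p \<le> q\<close> makes the derivatives of the powers of \<open>t\<close> negligible.\<close>
    have \<tau>: "1 / t \<le> u ^ p"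
    proof -
      have "1 / t = t powr (- (real q / real q))" using elim(4) q by (simp add: powr_minus_divide)
      also have "\<dots> = u ^ q" unfolding u_def using elim(4) by (rule powr_neg_quotient)
      also have "\<dots> \<le> u ^ p" using u0 u1 p by (intro power_decreasing) auto
      finally show ?thesis .
    qed
    \<comment> \<open>The part of \<open>dS/dt\<close> of order above \<open>p\<close>, divided by \<open>u\<^sup>p\<close>.\<close>
    define es where "es = (\<Sum>i=p+1..q. u ^ (i - p) * \<sigma> i)"
    have es: "\<bar>es\<bar> \<le> e"
    proof -
      have "\<bar>es\<bar> \<le> (\<Sum>i=p+1..q. u * \<bar>\<sigma> i\<bar>)"
        unfolding es_def
      proof (rule order_trans[OF sum_abs sum_mono])
        fix i assume "i \<in> {p+1..q}"
        then have "u ^ (i - p) \<le> u ^ 1" using u0 u1 by (intro power_decreasing) auto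
        then show "\<bar>u ^ (i - p) * \<sigma> i\<bar> \<le> u * \<bar>\<sigma> i\<bar>" using u0 by (simp add: abs_mult mult_right_mono)
      qed
      also have "\<dots> \<le> (\<Sum>i\<le>q. u * \<bar>\<sigma> i\<bar>)" using u0 by (intro sum_mono2) auto
      also have "\<dots> = u * Bs" by (simp add: Bs_def sum_distrib_left)
      finally show ?thesis using u_Bs u0 by linarith
    qed
    have S': "(\<Sum>i\<le>q. \<sigma> i * t powr (- (real i / real q))) = s 0 + (\<Sum>i=1..p. u ^ i * \<sigma> i) + u ^ p * es"
    proof -
      have "{..q} = insert 0 ({1..p} \<union> {p+1..q})" using p by auto
      then have "(\<Sum>i\<le>q. u ^ i * \<sigma> i) = \<sigma> 0 + (\<Sum>i=1..p. u ^ i * \<sigma> i) + (\<Sum>i=p+1..q. u ^ i * \<sigma> i)"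
        by (simp add: sum.union_disjoint)
      moreover have "(\<Sum>i=p+1..q. u ^ i * \<sigma> i) = u ^ p * es"
        unfolding es_def sum_distrib_left
      proof (intro sum.cong refl)
        fix i assume "i \<in> {p+1..q}"
        then have "u ^ i = u ^ p * u ^ (i - p)" by (simp flip: power_add)
        then show "u ^ i * \<sigma> i = u ^ p * (u ^ (i - p) * \<sigma> i)" by simp
      qed
      moreover have "\<sigma> 0 = s 0" using q by (simp add: \<sigma>_def phase_deriv_coeff_def)
      ultimately show ?thesis using elim(4) by (simp add: powr_neg_quotient u_def mult.commute)
    qed
    show ?case
    proof (intro allI impI)
      fix r \<phi> assume r: "m \<le> \<bar>r\<bar> \<and> \<bar>r\<bar> \<le> a"
      then have rr: "\<bar>r\<bar> \<le> a" "\<bar>r\<bar> \<le> r0" "m \<le> \<bar>r\<bar>" "r \<noteq> 0" using a m by auto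
      obtain ef where ef: "\<bar>ef\<bar> \<le> e" "f r \<phi> S t = (\<Sum>i=1..p. u ^ i * fc i r \<phi> S) + u ^ p * ef"
        using elim rr(2) unfolding u_def by blast
      obtain eg where eg: "\<bar>eg\<bar> \<le> e" "g r \<phi> S t = (\<Sum>i=1..p. u ^ i * gc i r \<phi> S) + u ^ p * eg"
        using elim rr(2) unfolding u_def by blast
      have H: "\<omega> r * deriv (\<lambda>y. v k r y S) \<phi> + s 0 * deriv (\<lambda>y. v k r \<phi> y) S
          = (if k = p then \<Lambda> p r else 0) - fc k r \<phi> S
            - (\<Sum>i=1..<k. fc i r \<phi> S * deriv_within a (\<lambda>x. v (k - i) x \<phi> S) r
               + gc i r \<phi> S * deriv (\<lambda>y. v (k - i) r y S) \<phi> / r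
               + \<sigma> i * deriv (\<lambda>y. v (k - i) r \<phi> y) S)" if k: "k \<in> {1..p}" for k
      proof -
        have "\<Lambda> k r = (if k = p then \<Lambda> p r else 0)" using \<Lambda>0 k rr by auto
        moreover have "averaging_remainder a q \<sigma> fc gc \<Lambda> v k r \<phi> S =
            - (\<Sum>i=1..<k. fc i r \<phi> S * deriv_within a (\<lambda>x. v (k - i) x \<phi> S) r
               + gc i r \<phi> S * deriv (\<lambda>y. v (k - i) r y S) \<phi> / r
               + \<sigma> i * deriv (\<lambda>y. v (k - i) r \<phi> y) S)"
          using k p \<Lambda>0 rr v0 by (intro averaging_remainder_leading[OF a(1)]) auto
        ultimately show ?thesis using hom[OF k rr(1)] by (simp add: homological_rhs_def)
      qed
      have "\<bar>f r \<phi> S t + (\<Sum>k=1..p. u ^ k *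
             (f r \<phi> S t * deriv_within a (\<lambda>x. v k x \<phi> S) r
              + (\<omega> r + g r \<phi> S t / r) * deriv (\<lambda>y. v k r y S) \<phi>
              + (\<Sum>i\<le>q. \<sigma> i * t powr (- (real i / real q))) * deriv (\<lambda>y. v k r \<phi> y) S)
            - real k / real q * u ^ k * (1 / t) * v k r \<phi> S) - u ^ p * \<Lambda> p r\<bar> \<le> e * u ^ p * C"
        unfolding C_def
      proof (rule near_identity_drift_estimate[OF ef(2) eg(2) S' H])
        fix k assume k: "k \<in> {1..p}"
        have *: "Bv \<le> B" "Bf \<le> B" "Bg \<le> B" "Bs \<le> B" using Bs0 by (auto simp: B_def)
        show "\<bar>fc k r \<phi> S\<bar> \<le> B" using order_trans[OF Bf[OF k rr(2)] *(2)] .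
        show "\<bar>gc k r \<phi> S\<bar> \<le> B" using order_trans[OF Bg[OF k rr(2)] *(3)] .
        show "\<bar>\<sigma> k\<bar> \<le> B" using order_trans[OF Bs *(4)] k p by auto
        show "\<bar>v k r \<phi> S\<bar> \<le> B" "\<bar>deriv_within a (\<lambda>x. v k x \<phi> S) r\<bar> \<le> B"
          "\<bar>deriv (\<lambda>y. v k r y S) \<phi>\<bar> \<le> B" "\<bar>deriv (\<lambda>y. v k r \<phi> y) S\<bar> \<le> B"
          using order_trans[OF _ *(1)] Bv[OF k rr(1)] by blast+
      qed (use ef(1) eg(1) es m rr(3) u0 u1 ue \<tau> elim(4) p in simp_all)
      also have "e * u ^ p * C = \<eta> * u ^ p" using C by (simp add: e_def)
      finally show "\<bar>transformed_radius_rate a q p s v r \<phi> t (f r \<phi> (phase q s t) t)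
        (\<omega> r + g r \<phi> (phase q s t) t / r) - t powr (- (real p / real q)) * \<Lambda> p r\<bar>
      \<le> \<eta> * t powr (- (real p / real q))"
        unfolding transformed_radius_rate_def Let_def
        using elim(4) by (simp add: S_def \<sigma>_def u_def powr_neg_quotient)
    qed
  qed
qed

section \<open>Limits of the partial sums\<close>

text \<open>Induction on the polynomial: each factor \<open>ln t\<close> is absorbed by half of the available decay.\<close>

lemma powr_neg_times_poly_ln_tendsto_0:
  assumes "c > 0"
  shows "((\<lambda>t::real. t powr (- c) * poly P (ln t)) \<longlongrightarrow> 0) at_top"
  using assms
proof (induction P arbitrary: c)
  case 0
  then show ?case by simp
next
  case (pCons b P)
  have 1: "((\<lambda>t::real. t powr (- c)) \<longlongrightarrow> 0) at_top"
    and 2: "((\<lambda>t::real. t powr (- (c / 2)) * ln t) \<longlongrightarrow> 0) at_top"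
    using \<open>c > 0\<close> by real_asymp+
  have 3: "((\<lambda>t::real. t powr (- (c / 2)) * poly P (ln t)) \<longlongrightarrow> 0) at_top"
    using pCons by simp
  have "((\<lambda>t. t powr (- c) * b + (t powr (- (c / 2)) * ln t) * (t powr (- (c / 2)) * poly P (ln t)))
      \<longlongrightarrow> 0 * b + 0 * 0) at_top"
    by (intro tendsto_intros 1 2 3)
  moreover have "t powr (- c) * b + (t powr (- (c / 2)) * ln t) * (t powr (- (c / 2)) * poly P (ln t))
      = t powr (- c) * poly (pCons b P) (ln t)" for t :: real
  proof -
    have "t powr (- c) = t powr (- (c / 2)) * t powr (- (c / 2))" by (simp flip: powr_add)
    then show ?thesis by (simp add: algebra_simps)
  qed
  ultimately show ?case by simp
qed

lemma partial_sum_tendsto: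
  assumes "q \<ge> 1"
  shows "(partial_sum q \<rho>0 \<rho> M \<longlongrightarrow> \<rho>0) at_top"
proof -
  have "((\<lambda>t. \<rho>0 + (\<Sum>k=1..M. t powr (- (real k / real q)) * poly (\<rho> k) (ln t)))
      \<longlongrightarrow> \<rho>0 + (\<Sum>k=1..M. 0)) at_top"
    using assms by (intro tendsto_intros powr_neg_times_poly_ln_tendsto_0) auto
  then show ?thesis by (simp add: partial_sum_def[abs_def])
qed

section \<open>Leaving an interval under a positive drift\<close>

lemma drift_forces_growth:
  fixes W :: "real \<Rightarrow> real"
  assumes t: "0 < t1" "t1 \<le> te"
    and der: "\<And>t. t \<in> {t1..te} \<Longrightarrow> \<exists>D \<ge> c / t. (W has_real_derivative D) (at t within {t1..te})"
  shows "W te - W t1 \<ge> c * ln (te / t1)"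
proof -
  have "continuous_on {t1..te} W"
    using der DERIV_continuous unfolding continuous_on_eq_continuous_within by blast
  then have cont: "continuous_on {t1..te} (\<lambda>t. W t - c * ln t)"
    using t by (auto intro!: continuous_intros)
  have "W t1 - c * ln t1 \<le> W te - c * ln te"
  proof (rule DERIV_nonneg_imp_increasing_open[OF t(2) _ cont])
    fix x assume x: "t1 < x" "x < te"
    then obtain D where D: "D \<ge> c / x" "(W has_real_derivative D) (at x)"
      using der[of x] at_within_Icc_at[OF x] by auto
    have "((\<lambda>t. W t - c * ln t) has_real_derivative (D - c / x)) (at x)"
      using D(2) x t by (auto intro!: derivative_eq_intros)
    then show "\<exists>y. ((\<lambda>t. W t - c * ln t) has_real_derivative y) (at x) \<and> 0 \<le> y"
      using D(1) by force
  qed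
  then show ?thesis using t by (simp add: ln_div algebra_simps)
qed

text \<open>While the radius stays in \<open>[lo, hi]\<close>, the nearby quantity \<open>W\<close> increases, so the radius cannot come
  back to \<open>lo\<close>. It cannot stay for ever either, since the growth \<open>c ln (T / t\<^sub>1)\<close> of \<open>W\<close> up to time \<open>T\<close>
  exceeds the length of the interval.\<close>

lemma first_exit_through_upper_end:
  fixes r W :: "real \<Rightarrow> real"
  assumes t: "0 < t1" "t1 \<le> T" and cont: "continuous_on {t1..T} r" and c: "c > 0"
    and start: "lo + 2 * \<eta> < r t1" "r t1 < hi" and \<eta>: "0 \<le> \<eta>"
    and near: "\<And>t. t \<in> {t1..T} \<Longrightarrow> r t \<in> {lo..hi} \<Longrightarrow> \<bar>W t - r t\<bar> \<le> \<eta>"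
    and der: "\<And>t. t \<in> {t1..T} \<Longrightarrow> r t \<in> {lo..hi} \<Longrightarrow>
       \<exists>D \<ge> c / t. (W has_real_derivative D) (at t within {t1..T})"
    and T: "hi - lo < c * ln (T / t1)"
  shows "\<exists>te. t1 < te \<and> te \<le> T \<and> r te = hi \<and> (\<forall>t\<in>{t1..te}. r t \<in> {lo..hi})"
proof -
  have growth: "r te - r t1 \<ge> c * ln (te / t1) - 2 * \<eta>"
    if te: "te \<in> {t1..T}" and inside: "\<And>t. t \<in> {t1..te} \<Longrightarrow> r t \<in> {lo..hi}" for te
  proof -
    have "W te - W t1 \<ge> c * ln (te / t1)"
    proof (rule drift_forces_growth[OF t(1)])
      show "t1 \<le> te" using te by simp
      fix t assume t': "t \<in> {t1..te}"
      then obtain D where "D \<ge> c / t" "(W has_real_derivative D) (at t within {t1..T})"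
        using der[of t] inside[of t] te by auto
      moreover have "{t1..te} \<subseteq> {t1..T}" using te by auto
      ultimately show "\<exists>D \<ge> c / t. (W has_real_derivative D) (at t within {t1..te})"
        using has_field_derivative_subset by blast
    qed
    then show ?thesis using near[of te] near[of t1] inside[of te] inside[of t1] te by auto
  qed
  define A where "A = {t \<in> {t1..T}. r t \<notin> {lo<..<hi}}"
  have "A = {t1..T} \<inter> r -` (- {lo<..<hi})" by (auto simp: A_def)
  then have A_closed: "closed A"
    by (simp add: continuous_closed_preimage[OF cont] closed_Compl)
  have "A \<noteq> {}"
  proof
    assume "A = {}"
    then have inside: "\<And>t. t \<in> {t1..T} \<Longrightarrow> r t \<in> {lo<..<hi}" unfolding A_def by blast
    have "r T - r t1 \<ge> c * ln (T / t1) - 2 * \<eta>"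
      using growth[of T] inside t by force
    moreover have "r T < hi" using inside[of T] t by auto
    ultimately show False using start T by linarith
  qed
  \<comment> \<open>The first time at which the radius is outside the open interval.\<close>
  define te where "te = Inf A"
  have bdd: "bdd_below A" by (rule bdd_belowI[of _ t1]) (auto simp: A_def)
  have teA: "te \<in> A" unfolding te_def using closed_contains_Inf[OF \<open>A \<noteq> {}\<close> bdd A_closed] .
  have before: "r t \<in> {lo<..<hi}" if "t1 \<le> t" "t < te" for t
  proof -
    have "t \<notin> A" using cInf_lower[OF _ bdd, of t] that by (auto simp: te_def)
    then show ?thesis using that teA by (auto simp: A_def)
  qed
  have te: "t1 \<le> te" "te \<le> T" "r te \<notin> {lo<..<hi}" using teA by (auto simp: A_def)
  have "t1 \<noteq> te" using te start \<eta> by auto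
  with te have te_gt: "t1 < te" by simp
  have cont': "continuous_on {t1..te} r" using cont te by (auto intro: continuous_on_subset)
  \<comment> \<open>Beyond an end point, the intermediate value theorem would give an earlier exit.\<close>
  have at_te: "r te \<in> {lo..hi}"
  proof (rule ccontr)
    assume "r te \<notin> {lo..hi}"
    then consider "r te < lo" | "r te > hi" by auto
    then show False
    proof cases
      case 1
      then obtain x where "t1 \<le> x" "x \<le> te" "r x = lo"
        using IVT2'[of r te lo t1] start \<eta> te cont' by auto
      then show False using before[of x] 1 by (cases "x = te") auto
    next
      case 2
      then obtain x where "t1 \<le> x" "x \<le> te" "r x = hi"
        using IVT'[of r t1 hi te] start te cont' by auto
      then show False using before[of x] 2 by (cases "x = te") auto
    qed
  qed
  have inside: "r t \<in> {lo..hi}" if "t \<in> {t1..te}" for t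
    using before[of t] at_te that by (cases "t = te") auto
  have "c * ln (te / t1) \<ge> 0" using c t te_gt by (intro mult_nonneg_nonneg) auto
  then have "r te > lo" using growth[of te] inside te start by force
  then have "r te = hi" using te(3) at_te by auto
  show ?thesis using te_gt te(2) inside \<open>r te = hi\<close> by blast
qed

section \<open>Instability\<close>

theorem theorem7:
  fixes r0 r_star t_star \<rho>0 :: real
    and q p N n :: nat
    and \<omega> :: "real \<Rightarrow> real"
    and f g :: "real \<Rightarrow> real \<Rightarrow> real \<Rightarrow> real \<Rightarrow> real"
    and fc gc v :: "nat \<Rightarrow> real \<Rightarrow> real \<Rightarrow> real \<Rightarrow> real"
    and s :: "nat \<Rightarrow> real"
    and \<Lambda> :: "nat \<Rightarrow> real \<Rightarrow> real"
    and \<rho> :: "nat \<Rightarrow> real poly"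
    and \<Lambda>p' :: real
  assumes r0: "r0 > 0" and q: "q \<ge> 1"
    and smooth_\<omega>: "smooth_on \<omega> {-r0..r0}"
    and \<omega>_pos: "\<And>r. \<bar>r\<bar> \<le> r0 \<Longrightarrow> \<omega> r > 0"
    and smooth_f: "smooth_strip_time r0 f" and smooth_g: "smooth_strip_time r0 g"
    and periodic_f: "\<And>r t. \<bar>r\<bar> \<le> r0 \<Longrightarrow> t > 0 \<Longrightarrow> periodic2 (\<lambda>\<phi> S. f r \<phi> S t)"
    and periodic_g: "\<And>r t. \<bar>r\<bar> \<le> r0 \<Longrightarrow> t > 0 \<Longrightarrow> periodic2 (\<lambda>\<phi> S. g r \<phi> S t)"
    and series_f: "has_asymptotic_series r0 q f fc"
    and series_g: "has_asymptotic_series r0 q g gc"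
    and smooth_fc: "\<And>k. k \<ge> 1 \<Longrightarrow> smooth_strip r0 (fc k)"
    and smooth_gc: "\<And>k. k \<ge> 1 \<Longrightarrow> smooth_strip r0 (gc k)"
    and periodic_fc: "\<And>k r. k \<ge> 1 \<Longrightarrow> \<bar>r\<bar> \<le> r0 \<Longrightarrow> periodic2 (fc k r)"
    and periodic_gc: "\<And>k r. k \<ge> 1 \<Longrightarrow> \<bar>r\<bar> \<le> r0 \<Longrightarrow> periodic2 (gc k r)"
    and harmonics_fc: "\<And>k. k \<ge> 1 \<Longrightarrow> finite (S_frequencies r0 (fc k))"
    and harmonics_gc: "\<And>k. k \<ge> 1 \<Longrightarrow> finite (S_frequencies r0 (gc k))"
    and p: "p \<ge> 1"
    and order_below_p: "\<And>k \<phi> S. 1 \<le> k \<Longrightarrow> k < p \<Longrightarrow>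
          (\<lambda>r. \<bar>fc k r \<phi> S\<bar> + \<bar>gc k r \<phi> S\<bar>) \<in> O[at 0](\<lambda>r. r)"
    and mean_fp: "fourier_coeff (fc p 0) 0 0 \<noteq> 0"
    and s0: "s 0 > 0"
    and nonresonance: "\<And>k1 k2 :: int. \<bar>k1\<bar> + \<bar>k2\<bar> \<noteq> 0 \<Longrightarrow> of_int k1 * \<omega> 0 + of_int k2 * s 0 \<noteq> 0"
    and N: "p \<le> N" "N < 2 * p"
    and r_star: "0 < r_star" "r_star < r0"
    and averaging: "averaging_sequence r_star q N \<omega> s fc gc \<Lambda> v"
    and nonresonance_r_star:
      "\<And>r (k1 :: int) k2. \<bar>r\<bar> \<le> r_star \<Longrightarrow> k2 \<in> occurring_S_frequencies r_star q N s fc gc \<Lambda> v \<Longrightarrow>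
          \<bar>k1\<bar> + \<bar>k2\<bar> \<noteq> 0 \<Longrightarrow> of_int k1 * \<omega> r + of_int k2 * s 0 \<noteq> 0"
    and t_star: "t_star > 0"
      "near_identity_change r_star t_star (transformed_radius q N (phase q s) v)"
    and \<Lambda>_below_n: "\<And>k r. 1 \<le> k \<Longrightarrow> k \<le> n - 1 \<Longrightarrow> \<bar>r\<bar> \<le> r_star \<Longrightarrow> \<Lambda> k r = 0"
    and \<Lambda>_n: "\<exists>r. \<bar>r\<bar> \<le> r_star \<and> \<Lambda> n r \<noteq> 0"
    and n: "n = p" "p \<le> q"
    and \<rho>0: "0 < \<bar>\<rho>0\<bar>" "\<bar>\<rho>0\<bar> < r_star" "\<Lambda> p \<rho>0 = 0"
    and \<Lambda>_deriv: "(\<Lambda> p has_real_derivative \<Lambda>p') (at \<rho>0)" "\<Lambda>p' > 0"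
    and formal: "formal_solution r_star q N \<Lambda> \<rho>0 \<rho>"
  shows "\<forall>M\<ge>1. \<exists>\<epsilon>>0. \<forall>\<delta>0. 0 < \<delta>0 \<and> \<delta>0 < \<epsilon> \<longrightarrow>
    (\<exists>ts\<ge>t_star. \<exists>te>ts. \<exists>r \<phi>.
       solves_perturbed_system r0 \<omega> f g (phase q s) {ts..te} r \<phi> \<and>
       \<bar>r ts - partial_sum q \<rho>0 \<rho> M ts\<bar> \<le> \<delta>0 \<and>
       te powr ((real p - real n) / real q) * \<bar>r te - partial_sum q \<rho>0 \<rho> M te\<bar> \<ge> \<epsilon>)"
proof (intro allI impI)
  fix M :: nat
  have \<Lambda>0: "\<Lambda> k r = 0" if "1 \<le> k" "k < p" "\<bar>r\<bar> \<le> r_star" for k r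
    using \<Lambda>_below_n[of k r] that n(1) by simp
  have smv: "smooth_strip r_star (v k)" and perv: "\<bar>r\<bar> \<le> r_star \<Longrightarrow> periodic2 (v k r)"
    if "k \<in> {1..p}" for k r
    using averaging N that unfolding averaging_sequence_def Let_def by auto
  have "eventually (\<lambda>x. \<Lambda>p' / 2 < (\<Lambda> p x - \<Lambda> p \<rho>0) / (x - \<rho>0)) (at \<rho>0)"
    using \<Lambda>_deriv by (intro order_tendstoD(1)) (auto simp: has_field_derivative_iff)
  then obtain d0 where d0: "d0 > 0"
    "\<And>x. x \<noteq> \<rho>0 \<Longrightarrow> dist x \<rho>0 < d0 \<Longrightarrow> \<Lambda>p' / 2 < (\<Lambda> p x - \<Lambda> p \<rho>0) / (x - \<rho>0)"
    by (auto simp: eventually_at)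
  \<comment> \<open>Within the range of the difference quotient bound, and so small that \<open>\<rho>\<^sub>0 + d\<close> stays below \<open>r_star\<close> in modulus and on the same side of \<open>0\<close> as \<open>\<rho>\<^sub>0\<close>.\<close>
  define d where "d = min (d0 / 2) (min (\<bar>\<rho>0\<bar> / 2) ((r_star - \<bar>\<rho>0\<bar>) / 2))"
  have d: "d > 0" "d < d0" "d < \<bar>\<rho>0\<bar>" "d < r_star - \<bar>\<rho>0\<bar>"
    using d0(1) \<rho>0 by (auto simp: d_def min_def)
  have repelling: "\<Lambda> p x \<ge> \<Lambda>p' / 2 * (x - \<rho>0)" if "\<rho>0 < x" "x \<le> \<rho>0 + d" for x
    using d0(2)[of x] that d(2) \<rho>0(3) by (simp add: dist_real_def pos_less_divide_eq)
  define m where "m = \<bar>\<rho>0\<bar> - d"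
  have m: "m > 0" using d by (simp add: m_def)
  show "\<exists>\<epsilon>>0. \<forall>\<delta>0. 0 < \<delta>0 \<and> \<delta>0 < \<epsilon> \<longrightarrow>
    (\<exists>ts\<ge>t_star. \<exists>te>ts. \<exists>r \<phi>.
       solves_perturbed_system r0 \<omega> f g (phase q s) {ts..te} r \<phi> \<and>
       \<bar>r ts - partial_sum q \<rho>0 \<rho> M ts\<bar> \<le> \<delta>0 \<and>
       te powr ((real p - real n) / real q) * \<bar>r te - partial_sum q \<rho>0 \<rho> M te\<bar> \<ge> \<epsilon>)"
  proof (rule exI[of _ "d / 2"], intro conjI allI impI)
    show "d / 2 > 0" using d by simp
    fix \<delta> assume "0 < \<delta> \<and> \<delta> < d / 2"
    then have \<delta>: "0 < \<delta>" "\<delta> < d / 2" by auto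
    \<comment> \<open>Half of the lower bound \<open>\<Lambda>p' / 2 * (\<delta> / 2)\<close> of \<open>\<Lambda> p\<close> on \<open>[lo, hi]\<close>; the other half absorbs the averaging error.\<close>
    define c where "c = \<Lambda>p' * \<delta> / 8"
    have c: "c > 0" using \<delta> \<Lambda>_deriv by (simp add: c_def)
    define lo hi where "lo = \<rho>0 + \<delta> / 2" and "hi = \<rho>0 + d"
    have inside: "m \<le> \<bar>x\<bar>" "\<bar>x\<bar> < r_star" "\<Lambda> p x \<ge> 2 * c" if "x \<in> {lo..hi}" for x
    proof -
      show "m \<le> \<bar>x\<bar>" "\<bar>x\<bar> < r_star" using that d \<delta> by (auto simp: m_def lo_def hi_def)
      have "\<Lambda>p' / 2 * (\<delta> / 2) \<le> \<Lambda>p' / 2 * (x - \<rho>0)"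
        using that \<Lambda>_deriv by (intro mult_left_mono) (auto simp: lo_def)
      also have "\<dots> \<le> \<Lambda> p x" using that \<delta> by (intro repelling) (auto simp: lo_def hi_def)
      finally show "\<Lambda> p x \<ge> 2 * c" by (simp add: c_def)
    qed
    let ?W = "transformed_radius q p (phase q s) v"
    let ?S = "phase q s"
    have "eventually (\<lambda>t. \<bar>partial_sum q \<rho>0 \<rho> M t - \<rho>0\<bar> < \<delta> / 8) at_top"
      using tendstoD[OF partial_sum_tendsto[OF q], of "\<delta> / 8"] \<delta> by (simp add: dist_real_def)
    moreover have "eventually (\<lambda>t. \<forall>r \<phi>. \<bar>r\<bar> \<le> r_star \<longrightarrow> \<bar>?W r \<phi> t - r\<bar> \<le> \<delta> / 16) at_top"
      using \<delta> by (intro transformed_radius_near_identity r_star(1) q smv perv) auto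
    moreover have "eventually (\<lambda>t. \<forall>r \<phi>. m \<le> \<bar>r\<bar> \<and> \<bar>r\<bar> \<le> r_star \<longrightarrow>
       \<bar>transformed_radius_rate r_star q p s v r \<phi> t (f r \<phi> (?S t) t) (\<omega> r + g r \<phi> (?S t) t / r)
         - t powr (- (real p / real q)) * \<Lambda> p r\<bar> \<le> c * t powr (- (real p / real q))) at_top"
      by (rule averaged_radius_rate[OF r_star(1) less_imp_le[OF r_star(2)] q p n(2) N(1) series_f series_g
            smooth_fc smooth_gc periodic_fc periodic_gc averaging \<Lambda>0 m c])
    ultimately have "eventually (\<lambda>t. \<bar>partial_sum q \<rho>0 \<rho> M t - \<rho>0\<bar> < \<delta> / 8 \<and>
       (\<forall>r \<phi>. \<bar>r\<bar> \<le> r_star \<longrightarrow> \<bar>?W r \<phi> t - r\<bar> \<le> \<delta> / 16) \<and>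
       (\<forall>r \<phi>. m \<le> \<bar>r\<bar> \<and> \<bar>r\<bar> \<le> r_star \<longrightarrow>
         \<bar>transformed_radius_rate r_star q p s v r \<phi> t (f r \<phi> (?S t) t) (\<omega> r + g r \<phi> (?S t) t / r)
           - t powr (- (real p / real q)) * \<Lambda> p r\<bar> \<le> c * t powr (- (real p / real q)))) at_top"
      by (intro eventually_conj)
    then obtain t0 where t0:
      "\<And>t. t \<ge> t0 \<Longrightarrow> \<bar>partial_sum q \<rho>0 \<rho> M t - \<rho>0\<bar> < \<delta> / 8"
      "\<And>t r \<phi>. t \<ge> t0 \<Longrightarrow> \<bar>r\<bar> \<le> r_star \<Longrightarrow> \<bar>?W r \<phi> t - r\<bar> \<le> \<delta> / 16"
      "\<And>t r \<phi>. t \<ge> t0 \<Longrightarrow> m \<le> \<bar>r\<bar> \<Longrightarrow> \<bar>r\<bar> \<le> r_star \<Longrightarrow>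
         \<bar>transformed_radius_rate r_star q p s v r \<phi> t (f r \<phi> (?S t) t) (\<omega> r + g r \<phi> (?S t) t / r)
           - t powr (- (real p / real q)) * \<Lambda> p r\<bar> \<le> c * t powr (- (real p / real q))"
      unfolding eventually_at_top_linorder by blast
    define ts where "ts = max t_star (max t0 1)"
    have ts: "ts \<ge> t_star" "ts \<ge> t0" "ts \<ge> 1" by (auto simp: ts_def)
    \<comment> \<open>Chosen so that the logarithmic growth \<open>c * ln (T / ts)\<close> is \<open>hi - lo + 1\<close>.\<close>
    define T where "T = ts * exp ((hi - lo + 1) / c)"
    have lohi: "lo < hi" using \<delta> by (simp add: lo_def hi_def)
    have T: "ts \<le> T" "hi - lo < c * ln (T / ts)"
      using ts c lohi by (auto simp: T_def mult_le_cancel_left1)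
    have S_cont: "continuous_on {ts..T} ?S"
      by (rule DERIV_continuous_on[OF has_field_derivative_at_within[OF phase_has_real_derivative[OF _ q]]])
        (use ts in auto)
    have sub: "{lo..hi} \<subseteq> {-r0..r0}" and no0: "0 \<notin> {lo..hi}"
      using inside(1,2) m r_star by (fastforce simp: abs_less_iff)+
    have "\<exists>r \<phi>. r ts = partial_sum q \<rho>0 \<rho> M ts + \<delta> \<and> \<phi> ts = 0 \<and> continuous_on {ts..T} r \<and>
      (\<forall>t\<in>{ts..T}. r t \<in> {lo..hi} \<longrightarrow>
         (r has_real_derivative f (r t) (\<phi> t) (?S t) t) (at t within {ts..T}) \<and>
         (\<phi> has_real_derivative \<omega> (r t) + g (r t) (\<phi> t) (?S t) t / r t) (at t within {ts..T}))"
      by (rule perturbed_system_solution_while_in_interval[OF r0 smooth_\<omega> smooth_f smooth_g periodic_f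
            periodic_g S_cont _ T(1) less_imp_le[OF lohi] sub no0]) (use ts in simp_all)
    then obtain r \<phi> where r_ts: "r ts = partial_sum q \<rho>0 \<rho> M ts + \<delta>"
      and r_cont: "continuous_on {ts..T} r"
      and dr: "\<And>t. t \<in> {ts..T} \<Longrightarrow> r t \<in> {lo..hi} \<Longrightarrow>
         (r has_real_derivative f (r t) (\<phi> t) (?S t) t) (at t within {ts..T})"
      and d\<phi>: "\<And>t. t \<in> {ts..T} \<Longrightarrow> r t \<in> {lo..hi} \<Longrightarrow>
         (\<phi> has_real_derivative \<omega> (r t) + g (r t) (\<phi> t) (?S t) t / r t) (at t within {ts..T})"
      by blast
    have rate: "\<exists>D \<ge> c / t. ((\<lambda>t. ?W (r t) (\<phi> t) t) has_real_derivative D) (at t within {ts..T})"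
      if t: "t \<in> {ts..T}" and rt: "r t \<in> {lo..hi}" for t
    proof -
      let ?D = "transformed_radius_rate r_star q p s v (r t) (\<phi> t) t (f (r t) (\<phi> t) (?S t) t)
          (\<omega> (r t) + g (r t) (\<phi> t) (?S t) t / r t)"
      let ?u = "t powr (- (real p / real q))"
      have t1: "t \<ge> 1" "t \<ge> t0" using t ts by auto
      have "((\<lambda>t. ?W (r t) (\<phi> t) t) has_real_derivative ?D) (at t within {ts..T})"
        using t1 by (intro transformed_radius_has_derivative r_star(1) q smv perv inside(2) rt dr d\<phi> t) auto
      moreover have "?D \<ge> c / t"
      proof -
        have "?u * (c + c) \<le> ?u * \<Lambda> p (r t)" using inside(3)[OF rt] by (intro mult_left_mono) auto
        then have "c * ?u + c * ?u \<le> ?u * \<Lambda> p (r t)" by (simp only: distrib_left mult.commute[of c])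
        moreover have "\<bar>?D - ?u * \<Lambda> p (r t)\<bar> \<le> c * ?u"
          using t0(3)[OF t1(2) inside(1)[OF rt] less_imp_le[OF inside(2)[OF rt]]] .
        ultimately have "?D \<ge> c * ?u" by linarith
        moreover have "?u \<ge> t powr (- 1)" using t1 n(2) q by (intro powr_mono) auto
        then have "c * ?u \<ge> c * t powr (- 1)" using c by (intro mult_left_mono) auto
        then have "c * ?u \<ge> c / t" using t1 by (simp add: powr_minus_divide)
        ultimately show ?thesis by linarith
      qed
      ultimately show ?thesis by blast
    qed
    have near_ts: "\<bar>partial_sum q \<rho>0 \<rho> M ts - \<rho>0\<bar> < \<delta> / 8" using t0(1) ts by blast
    have near_W: "\<bar>?W (r t) (\<phi> t) t - r t\<bar> \<le> \<delta> / 16" if "t \<in> {ts..T}" "r t \<in> {lo..hi}" for t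
      using t0(2)[of t "r t"] inside(2)[OF that(2)] that(1) ts by auto
    \<comment> \<open>The partial sum is within \<open>\<delta> / 8\<close> of \<open>\<rho>\<^sub>0\<close>, so the start lies between \<open>\<rho>\<^sub>0 + 7 \<delta> / 8\<close> and \<open>\<rho>\<^sub>0 + 9 \<delta> / 8\<close>.\<close>
    have start: "lo + 2 * (\<delta> / 16) < r ts" "r ts < hi"
      unfolding r_ts lo_def hi_def using near_ts \<delta> by linarith+
    have "\<exists>te. ts < te \<and> te \<le> T \<and> r te = hi \<and> (\<forall>t\<in>{ts..te}. r t \<in> {lo..hi})"
      by (rule first_exit_through_upper_end[OF _ T(1) r_cont c start _ near_W rate T(2)])
        (use ts \<delta> in simp_all)
    then obtain te where te: "ts < te" "te \<le> T" "r te = hi" "\<And>t. t \<in> {ts..te} \<Longrightarrow> r t \<in> {lo..hi}"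
      by blast
    have "solves_perturbed_system r0 \<omega> f g ?S {ts..te} r \<phi>"
      unfolding solves_perturbed_system_def
    proof (intro ballI conjI)
      fix t assume t: "t \<in> {ts..te}"
      note rt = te(4)[OF t]
      show "r t \<noteq> 0" "\<bar>r t\<bar> \<le> r0" using rt sub no0 by force+
      have tT: "t \<in> {ts..T}" and sT: "{ts..te} \<subseteq> {ts..T}" using t te by auto
      show "(r has_real_derivative f (r t) (\<phi> t) (?S t) t) (at t within {ts..te})"
        by (rule has_field_derivative_subset[OF dr[OF tT rt] sT])
      show "(\<phi> has_real_derivative \<omega> (r t) + g (r t) (\<phi> t) (?S t) t / r t) (at t within {ts..te})"
        by (rule has_field_derivative_subset[OF d\<phi>[OF tT rt] sT])
    qed
    moreover have "\<bar>r ts - partial_sum q \<rho>0 \<rho> M ts\<bar> \<le> \<delta>" using \<delta> by (simp add: r_ts)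
    moreover have "\<bar>r te - partial_sum q \<rho>0 \<rho> M te\<bar> \<ge> d / 2"
      using t0(1)[of te] te(1) ts(2) \<delta> unfolding te(3) hi_def by linarith
    then have "te powr ((real p - real n) / real q) * \<bar>r te - partial_sum q \<rho>0 \<rho> M te\<bar> \<ge> d / 2"
      using te(1) ts(3) n(1) by simp
    ultimately show "\<exists>ts\<ge>t_star. \<exists>te>ts. \<exists>r \<phi>.
       solves_perturbed_system r0 \<omega> f g (phase q s) {ts..te} r \<phi> \<and>
       \<bar>r ts - partial_sum q \<rho>0 \<rho> M ts\<bar> \<le> \<delta> \<and>
       te powr ((real p - real n) / real q) * \<bar>r te - partial_sum q \<rho>0 \<rho> M te\<bar> \<ge> d / 2"
      using ts(1) te(1) by blast
  qed
qed

end
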